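(* Let $\Pi$ be a Gibbs partition with parameters $(\alpha,V)$, let $n,m\ge1$, and condition on the restriction of $\Pi$ to $[n]$ being a given partition into $j$ blocks with sizes $(n_1,\dots,n_j)$. Let $K_m$ be the number of new blocks generated by the integers $n+1,\dots,n+m$, let $S_1,\dots,S_{K_m}$ be their sizes in exchangeable random order, and for $l\in\{1,\dots,m\}$ let $W^{(n)}_{l,m}=\sum_{i=1}^{K_m}1\{S_i=l\}$. Then the Bayesian nonparametric estimator under quadratic loss of the (random) probability $$P^{n+m+1}_{new,l}(\alpha,V)=\frac{V_{n+m+1,j+K_m}}{V_{n+m,j+K_m}}(l-\alpha)W^{(n)}_{l,m}$$ that observation $n+m+1$ belongs to a new species represented $l$ times is $$\mathbb{E}\left(\frac{V_{n+m+1,j+K_m}}{V_{n+m,j+K_m}}(l-\alpha)W^{(n)}_{l,m}\right)=(l-\alpha)\sum_{k-1=0}^{m-l}\frac{V_{n+m+1,j+k}}{V_{n,j}}\binom ml(1-\alpha)_{l-1}\,S^{-1,-\alpha,-(n-j\alpha)}_{m-l,k-1},$$ where the expectation is with respect to the conditional law of $(S_1,\dots,S_{K_m},K_m)$ given the partition of $[n]$ (which depends on it only through $n$ and $K_n=j$).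
   Context: Notation: $(x)_n=x(x+1)\cdots(x+n-1)$ ($(x)_0=1$); $\sum_{k-1=0}^{M}$ means $k$ ranges over $1,\dots,1+M$. The Bayesian estimator under quadratic loss is the conditional expectation given the observed partition of $[n]$ (blocks are "species"). Gibbs partition with parameters $(\alpha,V)$: $\alpha\in(-\infty,1)$ and $V=(V_{n,k})_{1\le k\le n}$ are nonnegative weights with $V_{1,1}=1$ and $V_{n,k}=(n-k\alpha)V_{n+1,k}+V_{n+1,k+1}$; $\Pi$ is the exchangeable random partition of the positive integers such that for every $n$ and every partition $\{A_1,\dots,A_k\}$ of $[n]=\{1,\dots,n\}$, the restriction $\Pi_n$ of $\Pi$ to $[n]$ satisfies $\mathbb{P}(\Pi_n=\{A_1,\dots,A_k\})=V_{n,k}\prod_{i=1}^k(1-\alpha)_{|A_i|-1}$. $K_n$ is the number of blocks of $\Pi_n$. Conditional setting: it is assumed $V_{n,j}>0$. Given $\Pi_n$ (with $j$ blocks of sizes $n_1,\dots,n_j$), a block of $\Pi_{n+m}$ is old if it meets $[n]$, new otherwise. Exchangeable random order: given the new blocks, they are listed in uniformly random order (independent of everything else). The conditional probability that $\Pi_{n+m}$ equals a specified partition extending $\Pi_n$, in which the old blocks gain $m_1,\dots,m_j\ge0$ elements and there are $k$ new blocks of sizes $s_1,\dots,s_k\ge1$, is $\frac{V_{n+m,j+k}}{V_{n,j}}\prod_{i=1}^j(n_i-\alpha)_{m_i}\prod_{i=1}^k(1-\alpha)_{s_i-1}$. (In particular $V_{n+m,j+K_m}>0$ almost surely.) Generalized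 central Stirling numbers: $S^{-1,-\alpha}_{n,k}=\frac{n!}{k!}\sum_{(n_1,\dots,n_k)}\prod_{j=1}^k\frac{(1-\alpha)_{n_j-1}}{n_j!}$, the sum being over compositions of $n$ into $k$ positive parts ($S_{0,0}^{-1,-\alpha}=1$, $S_{n,0}^{-1,-\alpha}=0$ for $n\ge1$, $S_{n,k}^{-1,-\alpha}=0$ for $k>n$). Generalized non-central Stirling numbers: $S^{-1,-\alpha,\gamma}_{n,k}=\sum_{s=k}^n\binom ns S^{-1,-\alpha}_{s,k}(-\gamma)_{n-s}$. *)

theory Defs
  imports
    "HOL-Probability.Probability"
    "HOL-Library.Disjoint_Sets"
    "HOL-Combinatorics.Multiset_Permutations"
begin

definition gibbs_weights :: "real \<Rightarrow> (nat \<Rightarrow> nat \<Rightarrow> real) \<Rightarrow> bool" where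
  "gibbs_weights \<alpha> V \<longleftrightarrow> \<alpha> < 1 \<and> V 1 1 = 1 \<and>
     (\<forall>n k. 1 \<le> k \<and> k \<le> n \<longrightarrow>
        0 \<le> V n k \<and> V n k = (real n - real k * \<alpha>) * V (n + 1) k + V (n + 1) (k + 1))"

definition restr :: "nat \<Rightarrow> nat set set \<Rightarrow> nat set set" where
  "restr n P = (\<lambda>A. A \<inter> {1..n}) ` P - {{}}"

definition gibbs_partition ::
  "'a measure \<Rightarrow> real \<Rightarrow> (nat \<Rightarrow> nat \<Rightarrow> real) \<Rightarrow> ('a \<Rightarrow> nat set set) \<Rightarrow> bool" where
  "gibbs_partition M \<alpha> V R \<longleftrightarrow>
     prob_space M \<and> gibbs_weights \<alpha> V \<and>
     (\<forall>\<omega>\<in>space M. partition_on {1..} (R \<omega>)) \<and>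
     (\<forall>n. (\<lambda>\<omega>. restr n (R \<omega>)) \<in> M \<rightarrow>\<^sub>M count_space UNIV) \<and>
     (\<forall>n\<ge>1. \<forall>p. partition_on {1..n} p \<longrightarrow>
        measure M {\<omega> \<in> space M. restr n (R \<omega>) = p} =
          V n (card p) * (\<Prod>A\<in>p. pochhammer (1 - \<alpha>) (card A - 1)))"

text \<open>Exchangeability is not a separate requirement: it follows from the product formula.\<close>

lemma gibbs_partition_exchangeable:
  assumes "gibbs_partition M \<alpha> V R" "n \<ge> 1" "partition_on {1..n} p" "\<sigma> permutes {1..n}"
  shows "measure M {\<omega> \<in> space M. restr n (R \<omega>) = (`) \<sigma> ` p} =
         measure M {\<omega> \<in> space M. restr n (R \<omega>) = p}"
proof -
  have inj: "inj \<sigma>"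
    using assms(4) by (rule permutes_inj)
  then have inj': "inj_on ((`) \<sigma>) p"
    by (meson inj_on_image inj_on_subset subset_UNIV)
  have "partition_on (\<sigma> ` {1..n}) ((`) \<sigma> ` p - {{}})"
    using assms(3) inj by (intro partition_on_inj_image) (auto intro: inj_on_subset)
  moreover have "(`) \<sigma> ` p - {{}} = (`) \<sigma> ` p"
    using partition_onD3[OF assms(3)] by auto
  ultimately have part: "partition_on {1..n} ((`) \<sigma> ` p)"
    using permutes_image[OF assms(4)] by simp
  have "card (\<sigma> ` A) = card A" for A
    using inj by (meson card_image inj_on_subset subset_UNIV)
  then show ?thesis
    using assms part inj' by (simp add: gibbs_partition_def card_image prod.reindex)
qed

definition new_blocks :: "nat \<Rightarrow> nat set set \<Rightarrow> nat set set" where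
  "new_blocks n q = {A \<in> q. A \<inter> {1..n} = {}}"

text \<open>
  \<open>B\<close> lists the blocks of the restriction of \<open>R\<close> to \<open>{1..n+m}\<close> that are new relative to
  \<open>{1..n}\<close>. Given \<open>R\<close>, all orders are equally likely; the events that
  fix a restriction \<open>restr N R\<close> with \<open>N \<ge> n + m\<close> generate the sigma-algebra of the whole
  partition, so it suffices to condition on these.
\<close>

definition exchangeable_order ::
  "'a measure \<Rightarrow> ('a \<Rightarrow> nat set set) \<Rightarrow> nat \<Rightarrow> nat \<Rightarrow> ('a \<Rightarrow> nat set list) \<Rightarrow> bool" where
  "exchangeable_order M R n m B \<longleftrightarrow>
     B \<in> M \<rightarrow>\<^sub>M count_space UNIV \<and>
     (\<forall>\<omega>\<in>space M. B \<omega> \<in> permutations_of_set (new_blocks n (restr (n + m) (R \<omega>)))) \<and>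
     (\<forall>N\<ge>n + m. \<forall>q. partition_on {1..N} q \<longrightarrow>
        (\<forall>bs\<in>permutations_of_set (new_blocks n (restr (n + m) q)).
           measure M {\<omega> \<in> space M. restr N (R \<omega>) = q \<and> B \<omega> = bs} =
             measure M {\<omega> \<in> space M. restr N (R \<omega>) = q}
               / fact (card (new_blocks n (restr (n + m) q)))))"

text \<open>The pair \<open>((S\<^sub>1, \<dots>, S\<^sub>K), K)\<close> of ordered new block sizes and number of new blocks.\<close>

definition new_sizes ::
  "('a \<Rightarrow> nat set set) \<Rightarrow> nat \<Rightarrow> nat \<Rightarrow> ('a \<Rightarrow> nat set list) \<Rightarrow> 'a \<Rightarrow> nat list \<times> nat" where
  "new_sizes R n m B \<omega> = (map card (B \<omega>), card (new_blocks n (restr (n + m) (R \<omega>))))"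

definition cond_law_sizes ::
  "'a measure \<Rightarrow> ('a \<Rightarrow> nat set set) \<Rightarrow> nat \<Rightarrow> nat \<Rightarrow> ('a \<Rightarrow> nat set list) \<Rightarrow> nat set set
     \<Rightarrow> (nat list \<times> nat) measure" where
  "cond_law_sizes M R n m B p =
     distr (uniform_measure M {\<omega> \<in> space M. restr n (R \<omega>) = p}) (count_space UNIV)
       (new_sizes R n m B)"

definition freq_count :: "nat \<Rightarrow> nat list \<times> nat \<Rightarrow> nat" where
  "freq_count l = (\<lambda>(s, k). \<Sum>i<k. if s ! i = l then 1 else 0)"

text \<open>The denominator is positive almost surely for the partition of \<open>{1..n+m}\<close>;
  elsewhere \<open>x / 0 = 0\<close> makes the quotient vanish.\<close>

definition P_new ::
  "real \<Rightarrow> (nat \<Rightarrow> nat \<Rightarrow> real) \<Rightarrow> nat \<Rightarrow> nat \<Rightarrow> nat \<Rightarrow> nat \<Rightarrow> nat list \<times> nat \<Rightarrow> real" where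
  "P_new \<alpha> V n m l j = (\<lambda>(s, k).
     V (n + m + 1) (j + k) / V (n + m) (j + k) * (real l - \<alpha>) * real (freq_count l (s, k)))"

definition P_new_rv ::
  "real \<Rightarrow> (nat \<Rightarrow> nat \<Rightarrow> real) \<Rightarrow> ('a \<Rightarrow> nat set set) \<Rightarrow> nat \<Rightarrow> nat \<Rightarrow> nat
     \<Rightarrow> ('a \<Rightarrow> nat set list) \<Rightarrow> 'a \<Rightarrow> real" where
  "P_new_rv \<alpha> V R n m l B \<omega> =
     P_new \<alpha> V n m l (card (restr n (R \<omega>))) (new_sizes R n m B \<omega>)"

definition next_in_new_species ::
  "'a measure \<Rightarrow> ('a \<Rightarrow> nat set set) \<Rightarrow> nat \<Rightarrow> nat \<Rightarrow> nat \<Rightarrow> 'a set" where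
  "next_in_new_species M R n m l =
     {\<omega> \<in> space M. \<exists>A\<in>new_blocks n (restr (n + m) (R \<omega>)).
        card A = l \<and> insert (n + m + 1) A \<in> restr (n + m + 1) (R \<omega>)}"

text \<open>
  Conditional expectation given the restriction to \<open>{1..n}\<close>; this is the Bayesian estimator of \<open>X\<close>
  under quadratic loss when \<open>{1..n}\<close> is the observed sample.
\<close>

definition cond_exp_restr ::
  "'a measure \<Rightarrow> ('a \<Rightarrow> nat set set) \<Rightarrow> nat \<Rightarrow> ('a \<Rightarrow> real) \<Rightarrow> 'a \<Rightarrow> real" where
  "cond_exp_restr M R n =
     real_cond_exp M (vimage_algebra (space M) (\<lambda>\<omega>. restr n (R \<omega>)) (count_space UNIV))"

definition compositions :: "nat \<Rightarrow> nat \<Rightarrow> nat list set" where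
  "compositions n k = {ns. length ns = k \<and> (\<forall>x\<in>set ns. 1 \<le> x) \<and> sum_list ns = n}"

text \<open>\<open>stirling_central \<alpha> n k\<close> is \<open>S\<close> with upper indices \<open>-1, -\<alpha>\<close>, and
  \<open>stirling_noncentral \<alpha> \<gamma> n k\<close> is \<open>S\<close> with upper indices \<open>-1, -\<alpha>, \<gamma>\<close>.\<close>

definition stirling_central :: "real \<Rightarrow> nat \<Rightarrow> nat \<Rightarrow> real" where
  "stirling_central \<alpha> n k = fact n / fact k *
     (\<Sum>ns\<in>compositions n k. \<Prod>x\<leftarrow>ns. pochhammer (1 - \<alpha>) (x - 1) / fact x)"

definition stirling_noncentral :: "real \<Rightarrow> real \<Rightarrow> nat \<Rightarrow> nat \<Rightarrow> real" where
  "stirling_noncentral \<alpha> \<gamma> n k =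
     (\<Sum>s=k..n. real (n choose s) * stirling_central \<alpha> s k * pochhammer (- \<gamma>) (n - s))"

end

(* Adding the element N + 1 to a partition of {1..N} multiplies its weight by |A| - \<alpha> when it
   joins the block A and by 1 when it opens a new block.  Hence the law of the multiset of new
   block sizes evolves by a recursion that sees the partition of {1..n} only through n and its number
   of blocks.  Applied to (size = k) and to (size = k) * (number of new blocks of size l), this
   recursion is the triangular recurrence of the noncentral Stirling numbers, which in turn comes
   from the differential equations (1 - x) f' = 1 - \<alpha> f and (1 - x) h' = \<theta> h for the exponential
   generating functions f of (1 - \<alpha>)_(i-1), i \<ge> 1, and h of (\<theta>)_i.  The restrictions of the partition
   take finitely many values, so conditional expectations are averages over atoms. *)

theory Submission
  imports Defs
begin

section \<open>Recurrences of the generalized Stirling numbers\<close>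

text \<open>The weights V stay outside the recursion. V depends on a partition only through its
  number of blocks, so it is constant once the number k of new blocks is fixed, and the quotient in
  the predictor turns the factor V(n+m, j+k) of the law into V(n+m+1, j+k). A vanishing denominator
  does no harm, since V(n+m, j+k) = 0 forces V(n+m+1, j+k) = 0. What is left is a sum free of V over
  the extensions of p. This sum is treated for an arbitrary test function F of the multiset of new
  block sizes, the insertion step acting on F instead of on a distribution. One identity then serves
  twice: with the multiplicity of l it gives the estimator, and with an F that counts the orders of
  the new blocks having a given list of sizes it shows which data of p the conditional law sees. The
  recursion for the multiplicity of l does not close by itself: it also produces the multiplicity of
  l - 1 and, for l = 1, the bare indicator of the size, which therefore has to be solved
  beforehand.\<close>

definition block_fps :: "real \<Rightarrow> real fps" where
  "block_fps \<alpha> = Abs_fps (\<lambda>i. if i = 0 then 0 else pochhammer (1 - \<alpha>) (i - 1) / fact i)"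

definition pochhammer_fps :: "real \<Rightarrow> real fps" where
  "pochhammer_fps \<theta> = Abs_fps (\<lambda>i. pochhammer \<theta> i / fact i)"

lemma nth_mult_one_minus_X:
  fixes F :: "'a::comm_ring_1 fps"
  shows "fps_nth (F * (1 - fps_X)) i = fps_nth F i - (if i = 0 then 0 else fps_nth F (i - 1))"
  by (simp add: algebra_simps)

lemma nth_deriv_mult_one_minus_X:
  fixes F :: "'a::comm_ring_1 fps"
  shows "fps_nth (fps_deriv F * (1 - fps_X)) i = of_nat (Suc i) * fps_nth F (Suc i) - of_nat i * fps_nth F i"
  by (cases i) (simp_all add: nth_mult_one_minus_X)

text \<open>For \<alpha> \<noteq> 0 the series is (1 - (1 - x)^\<alpha>) / \<alpha>, for \<alpha> =
  0 it is -log(1 - x); the differential equation covers both cases without dividing by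
  \<alpha>.\<close>

lemma block_fps_ode:
  "fps_deriv (block_fps \<alpha>) * (1 - fps_X) = 1 - fps_const \<alpha> * block_fps \<alpha>"
proof (rule fps_ext)
  fix i
  show "fps_nth (fps_deriv (block_fps \<alpha>) * (1 - fps_X)) i =
    fps_nth (1 - fps_const \<alpha> * block_fps \<alpha>) i"
  proof (cases i)
    case 0
    then show ?thesis
      by (simp add: nth_mult_one_minus_X block_fps_def)
  next
    case (Suc k)
    have "fps_nth (fps_deriv (block_fps \<alpha>) * (1 - fps_X)) i =
      pochhammer (1 - \<alpha>) (Suc k) / fact (Suc k) - pochhammer (1 - \<alpha>) k / fact k"
      unfolding nth_mult_one_minus_X by (simp add: Suc block_fps_def divide_simps)
    also have "\<dots> = - \<alpha> * (pochhammer (1 - \<alpha>) k / fact (Suc k))"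
      by (simp add: pochhammer_Suc divide_simps) (simp add: algebra_simps)
    finally show ?thesis
      by (simp add: Suc block_fps_def)
  qed
qed

text \<open>The series is (1 - x)^(-\<theta>).\<close>

lemma pochhammer_fps_ode:
  "fps_deriv (pochhammer_fps \<theta>) * (1 - fps_X) = fps_const \<theta> * pochhammer_fps \<theta>"
proof (rule fps_ext)
  fix i
  show "fps_nth (fps_deriv (pochhammer_fps \<theta>) * (1 - fps_X)) i =
    fps_nth (fps_const \<theta> * pochhammer_fps \<theta>) i"
    by (cases i) (simp_all add: nth_mult_one_minus_X pochhammer_fps_def pochhammer_Suc
        divide_simps, simp_all add: algebra_simps)
qed

text \<open>A coefficient of a k-th power is a sum over all lists of length k with sum n, zeros
  allowed. As \<open>block_fps\<close> has no constant term, lists with a zero entry contribute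
  nothing and exactly the compositions remain.\<close>

lemma stirling_central_eq_fps:
  "stirling_central \<alpha> n k = fact n / fact k * fps_nth (block_fps \<alpha> ^ k) n"
proof -
  have nth: "(\<Prod>x\<leftarrow>ns. fps_nth (block_fps \<alpha>) x) = (\<Prod>i = 0..<k. fps_nth (block_fps \<alpha>) (ns ! i))"
    if "length ns = k" for ns
    using that by (simp add: prod.list_conv_set_nth)
  have sub: "compositions n k \<subseteq> natpermute n k"
    by (auto simp: compositions_def natpermute_def)
  have "fps_nth (block_fps \<alpha> ^ k) n =
      (\<Sum>ns\<in>natpermute n k. \<Prod>x\<leftarrow>ns. fps_nth (block_fps \<alpha>) x)"
  proof (cases k)
    case 0
    then show ?thesis
      by (simp add: natpermute_0)
  next
    case (Suc k')
    show ?thesis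
      unfolding fps_power_nth_Suc Suc Suc_eq_plus1[symmetric] atLeastLessThanSuc_atLeastAtMost[symmetric]
      by (intro sum.cong refl nth[unfolded Suc, symmetric]) (simp add: natpermute_def)
  qed
  also have "\<dots> = (\<Sum>ns\<in>compositions n k. \<Prod>x\<leftarrow>ns. fps_nth (block_fps \<alpha>) x)"
  proof (rule sum.mono_neutral_right[OF _ sub])
    show "\<forall>ns\<in>natpermute n k - compositions n k. (\<Prod>x\<leftarrow>ns. fps_nth (block_fps \<alpha>) x) = 0"
    proof
      fix ns
      assume "ns \<in> natpermute n k - compositions n k"
      then have "0 \<in> set ns"
        by (auto simp: natpermute_def compositions_def Suc_le_eq)
      then show "(\<Prod>x\<leftarrow>ns. fps_nth (block_fps \<alpha>) x) = 0"
        by (auto simp: prod_list_zero_iff block_fps_def image_iff intro!: bexI[of _ 0])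
    qed
  qed (rule natpermute_finite)
  also have "\<dots> = (\<Sum>ns\<in>compositions n k. \<Prod>x\<leftarrow>ns. pochhammer (1 - \<alpha>) (x - 1) / fact x)"
    by (intro sum.cong refl arg_cong[of _ _ prod_list] map_cong)
      (force simp: block_fps_def compositions_def)+
  finally show ?thesis
    by (simp add: stirling_central_def)
qed

text \<open>The binomial convolution over s is a product of exponential generating functions. Its
  range may be extended down to s = 0 because the k-th power of a series without constant term
  starts in degree k.\<close>

lemma stirling_noncentral_eq_fps:
  "stirling_noncentral \<alpha> \<gamma> n k =
     fact n / fact k * fps_nth (pochhammer_fps (- \<gamma>) * block_fps \<alpha> ^ k) n"
proof -
  have zero: "fps_nth (block_fps \<alpha> ^ k) s = 0" if "s < k" for s
    using startsby_zero_power_prefix[of "block_fps \<alpha>" k] that by (auto simp: block_fps_def)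
  have "stirling_noncentral \<alpha> \<gamma> n k =
      (\<Sum>s = k..n. fact n / fact k * (fps_nth (block_fps \<alpha> ^ k) s * fps_nth (pochhammer_fps (- \<gamma>)) (n - s)))"
    unfolding stirling_noncentral_def
    by (intro sum.cong refl)
      (simp add: stirling_central_eq_fps binomial_fact pochhammer_fps_def field_simps)
  also have "\<dots> =
      (\<Sum>s = 0..n. fact n / fact k * (fps_nth (block_fps \<alpha> ^ k) s * fps_nth (pochhammer_fps (- \<gamma>)) (n - s)))"
    by (intro sum.mono_neutral_left) (auto simp: zero)
  finally show ?thesis
    by (simp add: mult.commute[of "pochhammer_fps _"] fps_mult_nth sum_distrib_left)
qed

lemma stirling_noncentral_0: "stirling_noncentral \<alpha> \<gamma> 0 k = of_bool (k = 0)"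
  by (simp add: stirling_noncentral_eq_fps pochhammer_fps_def block_fps_def power_0_left)

lemma stirling_noncentral_eq_0: "n < k \<Longrightarrow> stirling_noncentral \<alpha> \<gamma> n k = 0"
  by (simp add: stirling_noncentral_def)

lemma stirling_noncentral_Suc_0:
  "stirling_noncentral \<alpha> \<gamma> (Suc n) 0 = (real n - \<gamma>) * stirling_noncentral \<alpha> \<gamma> n 0"
  by (simp add: stirling_noncentral_eq_fps pochhammer_fps_def pochhammer_Suc)

text \<open>By the product rule and the two differential equations, (1 - x) (h f^(k+1))' =
  (-\<gamma> - (k+1) \<alpha>) h f^(k+1) + (k+1) h f^k; the constant 1 in the equation for f is what
  lowers the power. In degree n the factor 1 - x supplies the summand \<open>real n\<close>, and the
  factor k + 1 is absorbed by the change from (k+1)! to k!.\<close>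

lemma stirling_noncentral_Suc_Suc:
  "stirling_noncentral \<alpha> \<gamma> (Suc n) (Suc k) =
     (real n - \<gamma> - real (Suc k) * \<alpha>) * stirling_noncentral \<alpha> \<gamma> n (Suc k) +
     stirling_noncentral \<alpha> \<gamma> n k"
proof -
  define f h where "f = block_fps \<alpha>" and "h = pochhammer_fps (- \<gamma>)"
  have deriv: "fps_deriv (f ^ Suc k) = fps_const (real (Suc k)) * fps_deriv f * f ^ k"
    by (subst fps_deriv_power) simp
  have "fps_deriv (h * f ^ Suc k) * (1 - fps_X) =
      (fps_deriv h * (1 - fps_X)) * f ^ Suc k +
      h * fps_const (real (Suc k)) * f ^ k * (fps_deriv f * (1 - fps_X))"
    unfolding fps_deriv_mult deriv by (simp only: algebra_simps)
  also have "\<dots> = fps_const (- \<gamma> - real (Suc k) * \<alpha>) * (h * f ^ Suc k) +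
      fps_const (real (Suc k)) * (h * f ^ k)"
    unfolding f_def h_def block_fps_ode pochhammer_fps_ode
    by (simp add: algebra_simps flip: fps_const_sub fps_const_mult fps_const_neg del: of_nat_Suc)
  finally have "fps_nth (fps_deriv (h * f ^ Suc k) * (1 - fps_X)) n =
      (- \<gamma> - real (Suc k) * \<alpha>) * fps_nth (h * f ^ Suc k) n + real (Suc k) * fps_nth (h * f ^ k) n"
    by (simp del: of_nat_Suc power_Suc)
  then have rec: "real (Suc n) * fps_nth (h * f ^ Suc k) (Suc n) =
      (real n - \<gamma> - real (Suc k) * \<alpha>) * fps_nth (h * f ^ Suc k) n + real (Suc k) * fps_nth (h * f ^ k) n"
    unfolding nth_deriv_mult_one_minus_X by (simp add: algebra_simps del: power_Suc)
  have "stirling_noncentral \<alpha> \<gamma> (Suc n) (Suc k) =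
      fact n / fact (Suc k) * (real (Suc n) * fps_nth (h * f ^ Suc k) (Suc n))"
    by (simp add: stirling_noncentral_eq_fps f_def h_def)
  also have "\<dots> = (real n - \<gamma> - real (Suc k) * \<alpha>) * (fact n / fact (Suc k) * fps_nth (h * f ^ Suc k) n) +
      fact n / fact k * fps_nth (h * f ^ k) n"
  proof -
    have "fact n / fact k = fact n / fact (Suc k) * real (Suc k)"
      by simp
    then show ?thesis
      unfolding rec by (simp only: algebra_simps)
  qed
  finally show ?thesis
    by (simp add: stirling_noncentral_eq_fps f_def h_def)
qed

section \<open>One-step extensions of partitions\<close>

definition extensions :: "nat set set \<Rightarrow> nat \<Rightarrow> nat \<Rightarrow> nat set set set" where
  "extensions p n N = {q. partition_on {1..N} q \<and> restr n q = p}"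

text \<open>\<^term>\<open>A = {}\<close> encodes opening a new block.\<close>

definition extend :: "nat \<Rightarrow> nat set set \<Rightarrow> nat set \<Rightarrow> nat set set" where
  "extend N q A = insert (insert (Suc N) A) (q - {A})"

text \<open>The factor of the Gibbs probability that does not involve V.\<close>

definition block_weight :: "real \<Rightarrow> nat set set \<Rightarrow> real" where
  "block_weight \<alpha> q = (\<Prod>A\<in>q. pochhammer (1 - \<alpha>) (card A - 1))"

text \<open>A multiset, because the insertion weights and the estimator see neither the labels nor
  the order of the new blocks.\<close>

definition new_size_mset :: "nat \<Rightarrow> nat set set \<Rightarrow> nat multiset" where
  "new_size_mset n q = image_mset card (mset_set (new_blocks n q))"

lemma restr_restr: "n \<le> N \<Longrightarrow> restr n (restr N P) = restr n P"
proof -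
  assume "n \<le> N"
  then have "A \<inter> {1..N} \<inter> {1..n} = A \<inter> {1..n}" for A
    by auto
  then have *: "(\<lambda>A. A \<inter> {1..n}) ` (\<lambda>A. A \<inter> {1..N}) ` P = (\<lambda>A. A \<inter> {1..n}) ` P"
    unfolding image_image by simp
  have "restr n (restr N P) = (\<lambda>A. A \<inter> {1..n}) ` (\<lambda>A. A \<inter> {1..N}) ` P - {{}}"
    unfolding restr_def by blast
  then show ?thesis
    unfolding * restr_def .
qed

lemma partition_on_restr:
  assumes "partition_on S P" "{1..n} \<subseteq> S"
  shows "partition_on {1..n} (restr n P)"
proof -
  have "partition_on ({1..n} \<inter> S) ((\<inter>) {1..n} ` P - {{}})"
    using assms(1) by (rule partition_on_restrict)
  moreover have "{1..n} \<inter> S = {1..n}"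
    using assms(2) by auto
  moreover have "(\<inter>) {1..n} ` P = (\<lambda>A. A \<inter> {1..n}) ` P"
    by (simp add: Int_commute)
  ultimately show ?thesis
    by (simp add: restr_def)
qed

lemma partition_on_atLeastAtMostD:
  assumes "partition_on {1..N} q" "A \<in> q"
  shows "A \<subseteq> {1..N}" "A \<noteq> {}" "finite A" "Suc N \<notin> A" "card A \<ge> 1"
proof -
  show *: "A \<subseteq> {1..N}" "A \<noteq> {}"
    using assms by (auto simp: partition_on_def)
  from *(1) show fin: "finite A"
    by (rule finite_subset) simp
  show "Suc N \<notin> A"
    using * by auto
  show "card A \<ge> 1"
    using fin *(2) by (simp add: Suc_le_eq card_gt_0_iff)
qed

lemma finite_partition_on_atLeastAtMost: "partition_on {1..N::nat} q \<Longrightarrow> finite q"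
  by (rule finite_elements[OF finite_atLeastAtMost])

lemma restr_id:
  assumes "partition_on {1..N} q"
  shows "restr N q = q"
proof -
  have "A \<inter> {1..N} = A" if "A \<in> q" for A
    using partition_on_atLeastAtMostD(1)[OF assms that] by auto
  then have "(\<lambda>A. A \<inter> {1..N}) ` q = q"
    by simp
  then show ?thesis
    using partition_onD3[OF assms] by (simp add: restr_def)
qed

lemma finite_extensions: "finite (extensions p n N)"
  using finitely_many_partition_on[of "{1..N}"]
  by (rule rev_finite_subset) (auto simp: extensions_def)

lemma partition_on_extend:
  assumes q: "partition_on {1..N} q" and A: "A \<in> insert {} q"
  shows "partition_on {1..Suc N} (extend N q A)"
proof (rule partition_onI)
  have sub: "C \<subseteq> {1..N}" if "C \<in> q" for C
    using partition_on_atLeastAtMostD(1)[OF q that] .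
  have dj: "disjnt C D" if "C \<in> q" "D \<in> q" "C \<noteq> D" for C D
    using partition_onD2[OF q] that by (auto simp: disjoint_def disjnt_def)
  have un: "\<Union>q = {1..N}"
    using partition_onD1[OF q] by simp
  show "\<Union> (extend N q A) = {1..Suc N}"
  proof -
    have "\<Union> (extend N q A) = insert (Suc N) (\<Union>q)"
      using A by (auto simp: extend_def)
    then show ?thesis
      using un by (simp add: atLeastAtMostSuc_conv)
  qed
  show "{} \<notin> extend N q A"
    using partition_onD3[OF q] by (auto simp: extend_def)
  fix C D
  assume CD: "C \<in> extend N q A" "D \<in> extend N q A" "C \<noteq> D"
  have *: "disjnt (insert (Suc N) A) D" if "D \<in> q" "D \<noteq> A" for D
  proof -
    have "Suc N \<notin> D"
      using sub[OF that(1)] by auto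
    moreover have "disjnt A D"
      using A dj[of A D] that by auto
    ultimately show ?thesis
      by (simp add: disjnt_insert1)
  qed
  show "disjnt C D"
    using CD(1,2) unfolding extend_def
  proof (elim insertE DiffE)
    assume "C = insert (Suc N) A" "D = insert (Suc N) A"
    then show ?thesis
      using CD(3) by simp
  next
    assume "C = insert (Suc N) A" "D \<in> q" "D \<notin> {A}"
    then show ?thesis
      using *[of D] by simp
  next
    assume "D = insert (Suc N) A" "C \<in> q" "C \<notin> {A}"
    then show ?thesis
      using *[of C] by (simp add: disjnt_sym)
  next
    assume "C \<in> q" "D \<in> q"
    then show ?thesis
      using dj CD(3) by simp
  qed
qed

lemma restr_extend:
  assumes q: "partition_on {1..N} q" and A: "A \<in> insert {} q"
  shows "restr N (extend N q A) = q"
proof -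
  have *: "C \<inter> {1..N} = C" if "C \<in> insert {} q" for C
    using partition_on_atLeastAtMostD(1)[OF q] that by auto
  have "insert (Suc N) A \<inter> {1..N} = A"
    using *[OF A] by auto
  moreover have "(\<lambda>C. C \<inter> {1..N}) ` (q - {A}) = q - {A}"
    using * by (simp cong: image_cong_simp)
  ultimately have "restr N (extend N q A) = insert A (q - {A}) - {{}}"
    by (simp add: restr_def extend_def)
  also have "\<dots> = q"
    using partition_onD3[OF q] A by auto
  finally show ?thesis .
qed

text \<open>The witness is the trace on {1..N} of the block C that contains N + 1. It is empty
  exactly when C is a singleton, which is the case of a newly opened block.\<close>

lemma ex_extend:
  assumes q: "partition_on {1..Suc N} q"
  shows "\<exists>A\<in>insert {} (restr N q). q = extend N (restr N q) A"
proof -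
  obtain C where C: "C \<in> q" "Suc N \<in> C"
    using partition_onD1[OF q] atLeastAtMostSuc_conv[of 1 N] by (metis UnionE insertI1 le_add1 plus_1_eq_Suc)
  define A where "A = C \<inter> {1..N}"
  have CA: "C = insert (Suc N) A"
    using partition_on_atLeastAtMostD(1)[OF q C(1)] C(2)
    by (auto simp: A_def atLeastAtMostSuc_conv)
  have old: "D \<inter> {1..N} = D" if "D \<in> q - {C}" for D
  proof -
    have "Suc N \<notin> D"
      using partition_onD2[OF q] that C by (auto simp: disjoint_def)
    moreover have "D \<subseteq> {1..Suc N}"
      using partition_on_atLeastAtMostD(1)[OF q] that by auto
    ultimately show ?thesis
      by (auto simp: atLeastAtMostSuc_conv)
  qed
  have q_eq: "insert C (q - {C}) = q"
    using C by auto
  have "restr N q = (\<lambda>D. D \<inter> {1..N}) ` insert C (q - {C}) - {{}}"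
    unfolding q_eq restr_def ..
  also have "\<dots> = insert A (q - {C}) - {{}}"
  proof -
    have "(\<lambda>D. D \<inter> {1..N}) ` (q - {C}) = id ` (q - {C})"
      using old by (intro image_cong) simp_all
    then show ?thesis
      by (simp only: image_insert A_def image_id id_apply)
  qed
  finally have r: "restr N q = insert A (q - {C}) - {{}}" .
  \<comment> \<open>Another block would be nonempty and disjoint from C, whereas A lies inside C.
    Hence removing A from the restriction leaves precisely the blocks other than C.\<close>
  have "A \<notin> q - {C}"
  proof
    assume "A \<in> q - {C}"
    then have "A \<inter> C = {}" "A \<noteq> {}"
      using partition_onD2[OF q] partition_onD3[OF q] C by (auto simp: disjoint_def)
    then show False
      by (auto simp: A_def)
  qed
  then have "restr N q - {A} = q - {C}"
    using partition_onD3[OF q] unfolding r by blast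
  then have "extend N (restr N q) A = q"
    unfolding extend_def CA[symmetric] by (simp only: q_eq)
  moreover have "A \<in> insert {} (restr N q)"
    unfolding r by blast
  ultimately show ?thesis
    by metis
qed

lemma extend_notin:
  assumes "partition_on {1..N} q"
  shows "insert (Suc N) A \<notin> q"
  using partition_on_atLeastAtMostD(4)[OF assms] by blast

lemma inj_on_extend:
  assumes q: "partition_on {1..N} q"
  shows "inj_on (extend N q) (insert {} q)"
proof (rule inj_onI)
  have notin: "Suc N \<notin> C" if "C \<in> insert {} q" for C
    using partition_on_atLeastAtMostD(4)[OF q] that by auto
  fix A B
  assume AB: "A \<in> insert {} q" "B \<in> insert {} q" "extend N q A = extend N q B"
  have "insert (Suc N) A \<in> extend N q A"
    by (simp add: extend_def)
  then have "insert (Suc N) A = insert (Suc N) B"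
    unfolding AB(3) using extend_notin[OF q, of A] by (simp add: extend_def)
  then show "A = B"
    using insert_ident[OF notin[OF AB(1)] notin[OF AB(2)]] by simp
qed

lemma extensions_Suc:
  assumes "n \<le> N"
  shows "extensions p n (Suc N) = (\<Union>q\<in>extensions p n N. extend N q ` insert {} q)"
proof (intro equalityI subsetI)
  fix r
  assume r: "r \<in> extensions p n (Suc N)"
  then have part: "partition_on {1..Suc N} r" and rp: "restr n r = p"
    by (auto simp: extensions_def)
  have "partition_on {1..N} (restr N r)"
    using part by (rule partition_on_restr) auto
  then have "restr N r \<in> extensions p n N"
    using rp restr_restr[OF assms, of r] by (simp add: extensions_def)
  then show "r \<in> (\<Union>q\<in>extensions p n N. extend N q ` insert {} q)"
    using ex_extend[OF part] by blast
next
  fix r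
  assume "r \<in> (\<Union>q\<in>extensions p n N. extend N q ` insert {} q)"
  then obtain q A where q: "q \<in> extensions p n N" and A: "A \<in> insert {} q" and r: "r = extend N q A"
    by blast
  then have part: "partition_on {1..N} q"
    by (simp add: extensions_def)
  have "restr n r = restr n (restr N r)"
    using assms by (simp add: restr_restr)
  then show "r \<in> extensions p n (Suc N)"
    using q restr_extend[OF part A] partition_on_extend[OF part A] by (simp add: extensions_def r)
qed

text \<open>The extensions form a tree in which the parent of r is \<open>restr N r\<close>.
  Children of different partitions are therefore distinct, and the children of one q correspond
  injectively to the choice of A.\<close>

lemma sum_extensions_Suc:
  assumes "n \<le> N"
  shows "(\<Sum>r\<in>extensions p n (Suc N). G r) =
    (\<Sum>q\<in>extensions p n N. G (extend N q {}) + (\<Sum>A\<in>q. G (extend N q A)))"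
proof -
  have part: "partition_on {1..N} q" if "q \<in> extensions p n N" for q
    using that by (simp add: extensions_def)
  have fin: "finite q" if "q \<in> extensions p n N" for q
    using finite_partition_on_atLeastAtMost[OF part[OF that]] .
  have dj: "q = q'" if "q \<in> extensions p n N" "q' \<in> extensions p n N"
      "r \<in> extend N q ` insert {} q" "r \<in> extend N q' ` insert {} q'" for q q' r
    using restr_extend[OF part[OF that(1)]] restr_extend[OF part[OF that(2)]] that(3,4)
    by (metis imageE)
  have "(\<Sum>r\<in>extensions p n (Suc N). G r) =
      (\<Sum>q\<in>extensions p n N. \<Sum>r\<in>extend N q ` insert {} q. G r)"
    unfolding extensions_Suc[OF assms]
  proof (intro sum.UNION_disjoint finite_extensions ballI impI)
    fix q q'
    assume "q \<in> extensions p n N" "q' \<in> extensions p n N" "q \<noteq> q'"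
    then show "extend N q ` insert {} q \<inter> extend N q' ` insert {} q' = {}"
      using dj by blast
  qed (simp add: fin)
  also have "\<dots> = (\<Sum>q\<in>extensions p n N. \<Sum>A\<in>insert {} q. G (extend N q A))"
    by (intro sum.cong refl) (simp only: sum.reindex[OF inj_on_extend[OF part]] o_def)
  also have "\<dots> = (\<Sum>q\<in>extensions p n N. G (extend N q {}) + (\<Sum>A\<in>q. G (extend N q A)))"
    using fin partition_onD3[OF part] by (intro sum.cong refl) simp
  finally show ?thesis .
qed

section \<open>Effect of one insertion on weights and new block sizes\<close>

lemma block_weight_extend_empty:
  assumes q: "partition_on {1..N} q"
  shows "block_weight \<alpha> (extend N q {}) = block_weight \<alpha> q"
proof -
  have "{Suc N} \<notin> q" "q - {{}} = q"
    using partition_on_atLeastAtMostD(4)[OF q] partition_onD3[OF q] by auto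
  then show ?thesis
    using finite_partition_on_atLeastAtMost[OF q] by (simp add: block_weight_def extend_def)
qed

lemma card_extend:
  assumes q: "partition_on {1..N} q" and A: "A \<in> q"
  shows "card (extend N q A) = card q"
proof -
  have "card (extend N q A) = Suc (card (q - {A}))"
    unfolding extend_def using finite_partition_on_atLeastAtMost[OF q] extend_notin[OF q]
    by (subst card_insert_disjoint) auto
  then show ?thesis
    using card_Suc_Diff1[OF finite_partition_on_atLeastAtMost[OF q] A] by simp
qed

lemma block_weight_extend:
  assumes q: "partition_on {1..N} q" and A: "A \<in> q"
  shows "block_weight \<alpha> (extend N q A) = block_weight \<alpha> q * (real (card A) - \<alpha>)"
proof -
  note fin = finite_partition_on_atLeastAtMost[OF q]
  define g where "g C = pochhammer (1 - \<alpha>) (card C - 1)" for C :: "nat set"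
  \<comment> \<open>Blocks are nonempty, so the truncated subtraction in \<open>card A - 1\<close>
    loses nothing and the Pochhammer symbol gains exactly one factor.\<close>
  obtain a where a: "card A = Suc a"
    using partition_on_atLeastAtMostD(5)[OF q A] by (cases "card A") auto
  have "card (insert (Suc N) A) = Suc (card A)"
    using partition_on_atLeastAtMostD(3,4)[OF q A] by simp
  then have "g (insert (Suc N) A) = g A * (real (card A) - \<alpha>)"
    by (simp add: g_def a pochhammer_Suc algebra_simps)
  moreover have "prod g (extend N q A) = g (insert (Suc N) A) * prod g (q - {A})"
    unfolding extend_def using fin extend_notin[OF q] by (subst prod.insert) auto
  moreover have "prod g q = g A * prod g (q - {A})"
    using fin A by (rule prod.remove)
  ultimately show ?thesis
    unfolding block_weight_def g_def[symmetric] by simp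
qed

lemma new_size_mset_extend_empty:
  assumes q: "partition_on {1..N} q" and "n \<le> N"
  shows "new_size_mset n (extend N q {}) = add_mset 1 (new_size_mset n q)"
proof -
  have "new_blocks n (extend N q {}) = insert {Suc N} (new_blocks n q)"
    using \<open>n \<le> N\<close> partition_onD3[OF q] by (auto simp: new_blocks_def extend_def)
  moreover have "{Suc N} \<notin> new_blocks n q"
    using extend_notin[OF q, of "{}"] by (simp add: new_blocks_def)
  ultimately show ?thesis
    using finite_partition_on_atLeastAtMost[OF q] by (simp add: new_size_mset_def new_blocks_def)
qed

lemma new_size_mset_extend_old:
  assumes q: "partition_on {1..N} q" and "A \<in> q - new_blocks n q"
  shows "new_size_mset n (extend N q A) = new_size_mset n q"
proof -
  have "new_blocks n (extend N q A) = new_blocks n q"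
    using assms(2) by (auto simp: new_blocks_def extend_def)
  then show ?thesis
    by (simp add: new_size_mset_def)
qed

lemma new_size_mset_extend_new:
  assumes q: "partition_on {1..N} q" and A: "A \<in> new_blocks n q" and "n \<le> N"
  shows "new_size_mset n (extend N q A) = add_mset (Suc (card A)) (new_size_mset n q - {#card A#})"
proof -
  have Aq: "A \<in> q"
    using A by (simp add: new_blocks_def)
  have fin: "finite (new_blocks n q)"
    using finite_partition_on_atLeastAtMost[OF q] by (simp add: new_blocks_def)
  have "new_blocks n (extend N q A) = insert (insert (Suc N) A) (new_blocks n q - {A})"
    using A \<open>n \<le> N\<close> by (auto simp: new_blocks_def extend_def)
  moreover have "insert (Suc N) A \<notin> new_blocks n q - {A}"
    using extend_notin[OF q] by (simp add: new_blocks_def)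
  moreover have "card (insert (Suc N) A) = Suc (card A)"
    using partition_on_atLeastAtMostD(3,4)[OF q Aq] by simp
  moreover have "mset_set (new_blocks n q - {A}) = mset_set (new_blocks n q) - {#A#}"
    using A fin by (simp add: mset_set_Diff)
  moreover have "image_mset card (mset_set (new_blocks n q) - {#A#}) =
      image_mset card (mset_set (new_blocks n q)) - {#card A#}"
    using A fin by (subst image_mset_Diff) auto
  ultimately show ?thesis
    using fin by (simp add: new_size_mset_def)
qed

text \<open>Distinct blocks are disjoint, so old blocks have distinct nonempty traces on {1..n}; new
  blocks have the empty trace, which \<open>restr\<close> discards.\<close>

lemma card_old_blocks:
  assumes q: "partition_on {1..N} q"
  shows "card (q - new_blocks n q) = card (restr n q)"
proof -
  have "inj_on (\<lambda>A. A \<inter> {1..n}) (q - new_blocks n q)"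
  proof (rule inj_onI)
    fix A B
    assume *: "A \<in> q - new_blocks n q" "B \<in> q - new_blocks n q" "A \<inter> {1..n} = B \<inter> {1..n}"
    then have "A \<inter> B \<noteq> {}"
      by (auto simp: new_blocks_def)
    then show "A = B"
      using * partition_onD2[OF q] by (auto simp: disjoint_def)
  qed
  moreover have "restr n q = (\<lambda>A. A \<inter> {1..n}) ` (q - new_blocks n q)"
    by (auto simp: restr_def new_blocks_def)
  ultimately show ?thesis
    by (simp add: card_image)
qed

lemma card_eq_restr_plus_new:
  assumes q: "partition_on {1..N} q"
  shows "card q = card (restr n q) + card (new_blocks n q)"
proof -
  have fin: "finite q"
    using finite_partition_on_atLeastAtMost[OF q] .
  have "card q = card (q - new_blocks n q) + card (new_blocks n q)"
    using fin by (subst card_Un_disjoint[symmetric])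
      (auto simp: new_blocks_def intro!: arg_cong[of _ _ card])
  then show ?thesis
    by (simp add: card_old_blocks[OF q])
qed

lemma sum_card_partition:
  assumes q: "partition_on {1..N} q"
  shows "(\<Sum>A\<in>q. card A) = N"
proof -
  have "(\<Sum>A\<in>q. card A) = card (\<Union>q)"
    using partition_onD2[OF q] partition_on_atLeastAtMostD(3)[OF q]
    by (intro card_Union_disjoint[symmetric]) (auto simp: disjoint_def pairwise_def disjnt_def)
  then show ?thesis
    by (simp flip: partition_onD1[OF q])
qed

lemma size_new_size_mset: "size (new_size_mset n q) = card (new_blocks n q)"
  by (simp add: new_size_mset_def)

text \<open>Here the individual sizes of the old blocks disappear: only their total enters, which is
  N minus the total size of the new blocks, together with their number.\<close>

lemma sum_old_blocks:
  assumes q: "partition_on {1..N} q"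
  shows "(\<Sum>A\<in>q - new_blocks n q. real (card A) - \<alpha>) =
    real N - real (\<Sum>\<^sub># (new_size_mset n q)) - real (card (restr n q)) * \<alpha>"
proof -
  have fin: "finite q"
    using finite_partition_on_atLeastAtMost[OF q] .
  have "\<Sum>\<^sub># (new_size_mset n q) = (\<Sum>A\<in>new_blocks n q. card A)"
    by (simp add: new_size_mset_def sum_unfold_sum_mset)
  moreover have "(\<Sum>A\<in>q. card A) = (\<Sum>A\<in>q - new_blocks n q. card A) + (\<Sum>A\<in>new_blocks n q. card A)"
    using fin by (intro sum.subset_diff) (auto simp: new_blocks_def)
  ultimately have "real N = (\<Sum>A\<in>q - new_blocks n q. real (card A)) + real (\<Sum>\<^sub># (new_size_mset n q))"
    unfolding sum_card_partition[OF q] by simp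
  then show ?thesis
    by (simp add: sum_subtractf card_old_blocks[OF q])
qed

text \<open>The transition operator for inserting one element into a partition of {1..N}, acting on
  test functions. Its terms stand for opening a block, joining one of the j old blocks, which leaves
  \<mu> unchanged and has the total weight of \<open>sum_old_blocks\<close>, and joining a new block
  of size x. The weights are not normalised, since V is left out.\<close>

definition growth_step ::
  "real \<Rightarrow> nat \<Rightarrow> nat \<Rightarrow> (nat multiset \<Rightarrow> real) \<Rightarrow> nat multiset \<Rightarrow> real" where
  "growth_step \<alpha> j N F \<mu> =
     F (add_mset 1 \<mu>) + (real N - real (\<Sum>\<^sub># \<mu>) - real j * \<alpha>) * F \<mu> +
     (\<Sum>x\<in>#\<mu>. (real x - \<alpha>) * F (add_mset (Suc x) (\<mu> - {#x#})))"

text \<open>The test function is pulled back from {1..n+m} to {1..n}, the last insertion first. At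
  {1..n} there is no new block yet, hence the value at \<open>{#}\<close>.\<close>

fun growth :: "real \<Rightarrow> nat \<Rightarrow> nat \<Rightarrow> nat \<Rightarrow> (nat multiset \<Rightarrow> real) \<Rightarrow> real" where
  "growth \<alpha> j n 0 F = F {#}"
| "growth \<alpha> j n (Suc m) F = growth \<alpha> j n m (growth_step \<alpha> j (n + m) F)"

lemma extensions_self: "partition_on {1..n} p \<Longrightarrow> extensions p n n = {p}"
  by (auto simp: extensions_def restr_id)

text \<open>Group the extensions by their parent: splitting the choice of A into the empty set, old
  blocks and new blocks turns the inner sum into one growth step. That step alters the test
  function, so the induction runs over all F.\<close>

lemma sum_extensions_eq_growth:
  assumes p: "partition_on {1..n} p"
  shows "(\<Sum>q\<in>extensions p n (n + m). block_weight \<alpha> q * F (new_size_mset n q)) =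
    block_weight \<alpha> p * growth \<alpha> (card p) n m F"
proof (induction m arbitrary: F)
  case 0
  have "new_blocks n p = {}"
    using partition_on_atLeastAtMostD(1,2)[OF p] by (simp add: new_blocks_def Int_absorb2)
  then show ?case
    using p by (simp add: extensions_self new_size_mset_def)
next
  case (Suc m)
  have "block_weight \<alpha> (extend (n + m) q {}) * F (new_size_mset n (extend (n + m) q {})) +
      (\<Sum>A\<in>q. block_weight \<alpha> (extend (n + m) q A) * F (new_size_mset n (extend (n + m) q A))) =
      block_weight \<alpha> q * growth_step \<alpha> (card p) (n + m) F (new_size_mset n q)"
    if "q \<in> extensions p n (n + m)" for q
  proof -
    have q: "partition_on {1..n + m} q" and qp: "restr n q = p"
      using that by (auto simp: extensions_def)
    have fin: "finite q"
      using finite_partition_on_atLeastAtMost[OF q] .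
    define \<mu> where "\<mu> = new_size_mset n q"
    have old: "(\<Sum>A\<in>q - new_blocks n q. (real (card A) - \<alpha>) * F (new_size_mset n (extend (n + m) q A))) =
        (real (n + m) - real (\<Sum>\<^sub># \<mu>) - real (card p) * \<alpha>) * F \<mu>"
      unfolding \<mu>_def qp[symmetric] sum_old_blocks[OF q, symmetric] sum_distrib_right
      by (intro sum.cong refl) (simp add: new_size_mset_extend_old[OF q])
    have "(\<Sum>A\<in>new_blocks n q. (real (card A) - \<alpha>) * F (new_size_mset n (extend (n + m) q A))) =
        (\<Sum>A\<in>new_blocks n q. (real (card A) - \<alpha>) * F (add_mset (Suc (card A)) (\<mu> - {#card A#})))"
      by (intro sum.cong refl) (simp add: new_size_mset_extend_new[OF q] \<mu>_def)
    \<comment> \<open>Several new blocks may share a size; the sum over the multiset counts that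
      size with its multiplicity.\<close>
    also have "\<dots> = (\<Sum>x\<in>#\<mu>. (real x - \<alpha>) * F (add_mset (Suc x) (\<mu> - {#x#})))"
      by (simp add: \<mu>_def new_size_mset_def sum_unfold_sum_mset image_mset.compositionality o_def)
    finally have new: "(\<Sum>A\<in>new_blocks n q. (real (card A) - \<alpha>) * F (new_size_mset n (extend (n + m) q A))) =
        (\<Sum>x\<in>#\<mu>. (real x - \<alpha>) * F (add_mset (Suc x) (\<mu> - {#x#})))" .
    have "(\<Sum>A\<in>q. block_weight \<alpha> (extend (n + m) q A) * F (new_size_mset n (extend (n + m) q A))) =
        block_weight \<alpha> q * (\<Sum>A\<in>q. (real (card A) - \<alpha>) * F (new_size_mset n (extend (n + m) q A)))"
      unfolding sum_distrib_left by (intro sum.cong refl) (simp add: block_weight_extend[OF q])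
    also have "(\<Sum>A\<in>q. (real (card A) - \<alpha>) * F (new_size_mset n (extend (n + m) q A))) =
        (real (n + m) - real (\<Sum>\<^sub># \<mu>) - real (card p) * \<alpha>) * F \<mu> +
        (\<Sum>x\<in>#\<mu>. (real x - \<alpha>) * F (add_mset (Suc x) (\<mu> - {#x#})))"
      unfolding old[symmetric] new[symmetric]
      using fin by (intro sum.subset_diff) (auto simp: new_blocks_def)
    finally show ?thesis
      unfolding growth_step_def \<mu>_def[symmetric]
      using block_weight_extend_empty[OF q] new_size_mset_extend_empty[OF q, of n]
      by (simp add: \<mu>_def algebra_simps)
  qed
  then have "(\<Sum>r\<in>extensions p n (n + Suc m). block_weight \<alpha> r * F (new_size_mset n r)) =
      (\<Sum>q\<in>extensions p n (n + m). block_weight \<alpha> q * growth_step \<alpha> (card p) (n + m) F (new_size_mset n q))"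
    unfolding add_Suc_right by (subst sum_extensions_Suc) (simp_all only: le_add1 cong: sum.cong)
  then show ?case
    by (simp add: Suc.IH)
qed

section \<open>Counting new blocks of a given size\<close>

lemma sum_mset_size_minus:
  "(\<Sum>x\<in>#\<mu>. real x - \<alpha>) = real (\<Sum>\<^sub># \<mu>) - real (size \<mu>) * \<alpha>"
  by (induction \<mu>) (simp_all add: algebra_simps)

lemma sum_mset_of_bool_eq:
  "(\<Sum>x\<in>#\<mu>. g x * of_bool (x = l)) = (g l :: real) * real (count \<mu> l)"
  by (induction \<mu>) (auto simp: algebra_simps)

lemma growth_step_add:
  "growth_step \<alpha> j N (\<lambda>\<mu>. F \<mu> + G \<mu>) = (\<lambda>\<mu>. growth_step \<alpha> j N F \<mu> + growth_step \<alpha> j N G \<mu>)"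
  by (rule ext) (simp only: growth_step_def distrib_left sum_mset.distrib)

lemma growth_step_cmult:
  "growth_step \<alpha> j N (\<lambda>\<mu>. c * F \<mu>) = (\<lambda>\<mu>. c * growth_step \<alpha> j N F \<mu>)"
  by (rule ext) (simp only: growth_step_def distrib_left sum_mset_distrib_left mult.left_commute[of _ c])

lemma growth_add: "growth \<alpha> j n m (\<lambda>\<mu>. F \<mu> + G \<mu>) = growth \<alpha> j n m F + growth \<alpha> j n m G"
  by (induction m arbitrary: F G) (simp_all add: growth_step_add)

lemma growth_cmult: "growth \<alpha> j n m (\<lambda>\<mu>. c * F \<mu>) = c * growth \<alpha> j n m F"
  by (induction m arbitrary: F) (simp_all add: growth_step_cmult)

lemma growth_zero: "growth \<alpha> j n m (\<lambda>\<mu>. 0) = 0"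
  using growth_cmult[of \<alpha> j n m 0 "\<lambda>_. 0"] by simp

text \<open>Joining a block keeps the number of new blocks, and the total size of the new blocks
  cancels between the old and the new terms. Functions of the size alone are thus mapped to such
  functions.\<close>

lemma growth_step_size:
  "growth_step \<alpha> j N (\<lambda>\<mu>. of_bool (size \<mu> = k)) =
    (\<lambda>\<mu>. of_bool (Suc (size \<mu>) = k) + (real N - real k * \<alpha> - real j * \<alpha>) * of_bool (size \<mu> = k))"
proof
  fix \<mu> :: "nat multiset"
  have "(\<Sum>x\<in>#\<mu>. (real x - \<alpha>) * of_bool (size (add_mset (Suc x) (\<mu> - {#x#})) = k)) =
      (\<Sum>x\<in>#\<mu>. (real x - \<alpha>) * of_bool (size \<mu> = k))"
    by (intro arg_cong[of _ _ sum_mset] image_mset_cong) (simp add: size_Suc_Diff1 del: size_Diff_singleton)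
  also have "\<dots> = (real (\<Sum>\<^sub># \<mu>) - real (size \<mu>) * \<alpha>) * of_bool (size \<mu> = k)"
    by (simp add: sum_mset_size_minus flip: sum_mset_distrib_right)
  finally show "growth_step \<alpha> j N (\<lambda>\<mu>. of_bool (size \<mu> = k)) \<mu> =
      of_bool (Suc (size \<mu>) = k) + (real N - real k * \<alpha> - real j * \<alpha>) * of_bool (size \<mu> = k)"
    by (auto simp: growth_step_def algebra_simps)
qed

text \<open>With \<gamma> = -(n - j \<alpha>) the coefficient n + m - k \<alpha> - j \<alpha> equals
  m - \<gamma> - k \<alpha>, so a growth step is one step of the Stirling recurrence.\<close>

lemma growth_size:
  "growth \<alpha> j n m (\<lambda>\<mu>. of_bool (size \<mu> = k)) = stirling_noncentral \<alpha> (- (real n - real j * \<alpha>)) m k"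
proof (induction m arbitrary: k)
  case 0
  then show ?case
    by (cases k) (simp_all add: stirling_noncentral_0)
next
  case (Suc m)
  note IH = Suc
  have rec: "growth \<alpha> j n (Suc m) (\<lambda>\<mu>. of_bool (size \<mu> = k)) =
      growth \<alpha> j n m (\<lambda>\<mu>. of_bool (Suc (size \<mu>) = k)) +
      (real (n + m) - real k * \<alpha> - real j * \<alpha>) *
        stirling_noncentral \<alpha> (- (real n - real j * \<alpha>)) m k"
    unfolding growth.simps growth_step_size growth_add growth_cmult Suc ..
  show ?case
  proof (cases k)
    case 0
    then show ?thesis
      unfolding rec by (simp add: growth_zero stirling_noncentral_Suc_0 algebra_simps)
  next
    case (Suc k')
    have "growth \<alpha> j n m (\<lambda>\<mu>. of_bool (Suc (size \<mu>) = k)) =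
        stirling_noncentral \<alpha> (- (real n - real j * \<alpha>)) m k'"
      by (simp only: Suc nat.inject IH)
    then show ?thesis
      unfolding rec unfolding Suc stirling_noncentral_Suc_Suc by (simp add: algebra_simps)
  qed
qed

text \<open>Sources of the terms: the total weight of joining some block, diminished by l - \<alpha>
  for each block of size l, which loses that size when it grows; a block opened beside the existing
  blocks of size l; the opened block itself, if l = 1; a block of size l - 1 that grows to size l.
  The guard l > 0 protects the truncated l - 1.\<close>

lemma growth_step_count:
  "growth_step \<alpha> j N (\<lambda>\<mu>. of_bool (size \<mu> = k) * real (count \<mu> l)) =
    (\<lambda>\<mu>. (real N - real k * \<alpha> - real j * \<alpha> - (real l - \<alpha>)) * (of_bool (size \<mu> = k) * real (count \<mu> l)) +
      (of_bool (Suc (size \<mu>) = k) * real (count \<mu> l) +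
      (of_bool (l = 1) * of_bool (Suc (size \<mu>) = k) +
      (real l - 1 - \<alpha>) * (of_bool (l > 0) * (of_bool (size \<mu> = k) * real (count \<mu> (l - 1)))))))"
proof
  fix \<mu> :: "nat multiset"
  define b :: real where "b = of_bool (size \<mu> = k)"
  have "(\<Sum>x\<in>#\<mu>. (real x - \<alpha>) * (of_bool (size (add_mset (Suc x) (\<mu> - {#x#})) = k) *
          real (count (add_mset (Suc x) (\<mu> - {#x#})) l))) =
      (\<Sum>x\<in>#\<mu>. (b * real (count \<mu> l)) * (real x - \<alpha>) + (- b) * ((real x - \<alpha>) * of_bool (x = l))
         + b * of_bool (l > 0) * ((real x - \<alpha>) * of_bool (x = l - 1)))"
  proof (intro arg_cong[of _ _ sum_mset] image_mset_cong)
    fix x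
    assume x: "x \<in># \<mu>"
    have "size (add_mset (Suc x) (\<mu> - {#x#})) = size \<mu>"
      using x by (simp add: size_Suc_Diff1 del: size_Diff_singleton)
    moreover have "real (count (add_mset (Suc x) (\<mu> - {#x#})) l) =
        real (count \<mu> l) - of_bool (x = l) + of_bool (l > 0) * of_bool (x = l - 1)"
      using x by (auto simp: of_nat_diff Suc_le_eq simp flip: count_greater_zero_iff)
    ultimately show "(real x - \<alpha>) * (of_bool (size (add_mset (Suc x) (\<mu> - {#x#})) = k) *
          real (count (add_mset (Suc x) (\<mu> - {#x#})) l)) =
        (b * real (count \<mu> l)) * (real x - \<alpha>) + (- b) * ((real x - \<alpha>) * of_bool (x = l))
         + b * of_bool (l > 0) * ((real x - \<alpha>) * of_bool (x = l - 1))"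
      by (simp only: b_def) (simp add: algebra_simps)
  qed
  also have "\<dots> = b * real (count \<mu> l) * (real (\<Sum>\<^sub># \<mu>) - real k * \<alpha>) + (- b) * ((real l - \<alpha>) * real (count \<mu> l))
         + b * of_bool (l > 0) * ((real (l - 1) - \<alpha>) * real (count \<mu> (l - 1)))"
    unfolding sum_mset.distrib sum_mset_distrib_left[symmetric] sum_mset_size_minus sum_mset_of_bool_eq
    by (auto simp: b_def)
  finally show "growth_step \<alpha> j N (\<lambda>\<mu>. of_bool (size \<mu> = k) * real (count \<mu> l)) \<mu> =
     (real N - real k * \<alpha> - real j * \<alpha> - (real l - \<alpha>)) * (of_bool (size \<mu> = k) * real (count \<mu> l)) +
      (of_bool (Suc (size \<mu>) = k) * real (count \<mu> l) +
      (of_bool (l = 1) * of_bool (Suc (size \<mu>) = k) +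
      (real l - 1 - \<alpha>) * (of_bool (l > 0) * (of_bool (size \<mu> = k) * real (count \<mu> (l - 1))))))"
    unfolding growth_step_def b_def by (cases l) (auto simp: algebra_simps)
qed

text \<open>No block is empty, yet the recursion for size 1 formally refers to the multiplicity of
  0; this removes that term.\<close>

lemma growth_count_0: "growth \<alpha> j n m (\<lambda>\<mu>. of_bool (size \<mu> = k) * real (count \<mu> 0)) = 0"
proof (induction m arbitrary: k)
  case 0
  show ?case by simp
next
  case (Suc m)
  show ?case
    by (cases k) (simp_all only: growth.simps growth_step_count growth_add growth_cmult Suc, simp_all add: Suc growth_zero)
qed

lemma growth_count_size_0: "growth \<alpha> j n m (\<lambda>\<mu>. of_bool (size \<mu> = 0) * real (count \<mu> l)) = 0"
proof -
  have "(\<lambda>\<mu>. of_bool (size \<mu> = 0) * real (count \<mu> l)) = (\<lambda>_. 0)"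
    by auto
  then show ?thesis
    by (simp only: growth_zero)
qed

text \<open>Mark one new block of size l + 1. Its elements can be chosen in m choose l + 1 ways and
  carry the weight (1 - \<alpha>)_l, while the other m - l - 1 elements create k further new blocks
  as if the marked one were absent. The induction step is Pascal's rule, according to whether the
  last element lies in the marked block.\<close>

lemma growth_count:
  "growth \<alpha> j n m (\<lambda>\<mu>. of_bool (size \<mu> = Suc k) * real (count \<mu> (Suc l))) =
    real (m choose Suc l) * pochhammer (1 - \<alpha>) l *
    stirling_noncentral \<alpha> (- (real n - real j * \<alpha>)) (m - Suc l) k"
proof (induction m arbitrary: k l)
  case 0
  show ?case by simp
next
  case (Suc m)
  note IH = Suc
  define S where "S = stirling_noncentral \<alpha> (- (real n - real j * \<alpha>))"
  define T where "T l k = growth \<alpha> j n m (\<lambda>\<mu>. of_bool (size \<mu> = k) * real (count \<mu> l))" for l k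
  define a where "a = pochhammer (1 - \<alpha>) l"
  \<comment> \<open>The preceding column, set to zero for k = 0, so that the recurrences for k = 0
    and for k > 0 take the single form \<open>S_Suc\<close>.\<close>
  define S' where "S' i = (case k of 0 \<Rightarrow> 0 | Suc k' \<Rightarrow> S i k')" for i
  define r where "r i = real i + real n - real j * \<alpha> - real k * \<alpha>" for i
  have S_Suc: "S (Suc i) k = r i * S i k + S' i" for i
    by (cases k) (simp_all add: S_def S'_def r_def stirling_noncentral_Suc_0
        stirling_noncentral_Suc_Suc algebra_simps)
  have same: "T (Suc l) (Suc k) = real (m choose Suc l) * a * S (m - Suc l) k"
    unfolding T_def S_def a_def by (rule IH)
  have pred: "T (Suc l) k = real (m choose Suc l) * a * S' (m - Suc l)"
    unfolding T_def S'_def S_def a_def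
    by (cases k) (simp_all only: nat.case IH growth_count_size_0 mult_zero_right)
  \<comment> \<open>The last element completes the marked block: it opens that block if l = 0 and
    joins a block of size l otherwise.\<close>
  have lower: "of_bool (l = 0) * S m k + (real l - \<alpha>) * T l (Suc k) = real (m choose l) * a * S (m - l) k"
  proof (cases l)
    case 0
    then show ?thesis
      by (simp add: a_def T_def growth_count_0)
  next
    case (Suc l')
    have "T (Suc l') (Suc k) = real (m choose Suc l') * pochhammer (1 - \<alpha>) l' * S (m - Suc l') k"
      unfolding T_def S_def by (rule IH)
    then show ?thesis
      by (simp add: Suc a_def pochhammer_Suc algebra_simps)
  qed
  have "growth \<alpha> j n (Suc m) (\<lambda>\<mu>. of_bool (size \<mu> = Suc k) * real (count \<mu> (Suc l))) =
      (r m - (real (Suc l))) * T (Suc l) (Suc k) +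
      T (Suc l) k + (of_bool (l = 0) * S m k + (real l - \<alpha>) * T l (Suc k))"
    unfolding growth.simps growth_step_count growth_add growth_cmult
    by (simp add: T_def S_def r_def growth_size algebra_simps)
  also have "\<dots> = real (m choose Suc l) * a * ((r m - real (Suc l)) * S (m - Suc l) k + S' (m - Suc l)) +
      real (m choose l) * a * S (m - l) k"
    unfolding same pred lower by (simp add: algebra_simps)
  \<comment> \<open>Subtracting l + 1 from \<open>r m\<close> gives \<open>r\<close> at the index m
    - l - 1, so the bracket is one step of \<open>S_Suc\<close>. If m < l + 1 the binomial
    coefficient vanishes and the truncated index does not matter.\<close>
  also have "\<dots> = real (m choose Suc l) * a * S (m - l) k + real (m choose l) * a * S (m - l) k"
  proof (cases "Suc l \<le> m")
    case True
    then have "S (m - l) k = r (m - Suc l) * S (m - Suc l) k + S' (m - Suc l)"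
      using S_Suc[of "m - Suc l"] by (simp add: Suc_diff_Suc Suc_le_eq)
    moreover have "r (m - Suc l) = r m - real (Suc l)"
      using True by (simp add: r_def of_nat_diff)
    ultimately show ?thesis
      by simp
  next
    case False
    then show ?thesis
      by (simp add: binomial_eq_0)
  qed
  also have "\<dots> = real (Suc m choose Suc l) * a * S (Suc m - Suc l) k"
    by (simp add: algebra_simps)
  finally show ?case
    by (simp add: S_def a_def)
qed

section \<open>Conditioning on finitely many values\<close>

text \<open>The number of ways to read s when distinguishable elements with value multiset \<mu> are
  drawn one by one without replacement until none is left; equal values count separately. It makes
  the number of orders with a prescribed size list a function of the sizes alone.\<close>

primrec count_orders :: "'b list \<Rightarrow> 'b multiset \<Rightarrow> nat" where
  "count_orders [] \<mu> = of_bool (\<mu> = {#})"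
| "count_orders (x # s) \<mu> = count \<mu> x * count_orders s (\<mu> - {#x#})"

lemma count_image_mset_set:
  assumes "finite X"
  shows "count (image_mset f (mset_set X)) x = card {a \<in> X. f a = x}"
proof -
  have "f -` {x} \<inter> X = {a \<in> X. f a = x}"
    by auto
  then show ?thesis
    using assms by (simp add: count_image_mset)
qed

text \<open>Split by the first element a: the admissible choices are counted by the multiplicity of
  x, and whichever is taken, the same multiset of values remains.\<close>

lemma card_permutations_of_set_map:
  assumes "finite X"
  shows "card {bs \<in> permutations_of_set X. map f bs = s} = count_orders s (image_mset f (mset_set X))"
  using assms
proof (induction s arbitrary: X)
  case Nil
  have "{bs \<in> permutations_of_set X. map f bs = []} = (if X = {} then {[]} else {})"
    by (auto simp: permutations_of_set_def)
  then show ?case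
    using Nil by (simp add: mset_set_empty_iff)
next
  case (Cons x s)
  define Y where "Y a = {bs \<in> permutations_of_set (X - {a}). map f bs = s}" for a
  have "{bs \<in> permutations_of_set X. map f bs = x # s} = (\<Union>a\<in>{a \<in> X. f a = x}. (#) a ` Y a)"
  proof (intro equalityI subsetI)
    fix bs
    assume "bs \<in> {bs \<in> permutations_of_set X. map f bs = x # s}"
    then have "map f bs = x # s" and perm: "bs \<in> permutations_of_set X"
      by simp_all
    then obtain a as where bs: "bs = a # as" "f a = x" "map f as = s"
      by (cases bs) auto
    then have "a \<in> X" "as \<in> Y a"
      using perm by (auto simp: Y_def permutations_of_set_def)
    then show "bs \<in> (\<Union>a\<in>{a \<in> X. f a = x}. (#) a ` Y a)"
      using bs by blast
  next
    fix bs
    assume "bs \<in> (\<Union>a\<in>{a \<in> X. f a = x}. (#) a ` Y a)"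
    then obtain a as where "a \<in> X" "f a = x" "as \<in> Y a" "bs = a # as"
      by blast
    then show "bs \<in> {bs \<in> permutations_of_set X. map f bs = x # s}"
      by (simp add: Y_def permutations_of_set_def insert_absorb)
  qed
  moreover have "card (\<Union>a\<in>{a \<in> X. f a = x}. (#) a ` Y a) = (\<Sum>a\<in>{a \<in> X. f a = x}. card ((#) a ` Y a))"
    using Cons.prems by (intro card_UN_disjoint) (simp_all add: Y_def, blast)
  moreover have "card ((#) a ` Y a) = count_orders s (image_mset f (mset_set X) - {#x#})"
    if "a \<in> {a \<in> X. f a = x}" for a
  proof -
    have "image_mset f (mset_set (X - {a})) = image_mset f (mset_set X) - {#x#}"
      using that Cons.prems by (simp add: mset_set_Diff image_mset_Diff)
    then show ?thesis
      using Cons.IH[of "X - {a}"] Cons.prems by (simp add: Y_def card_image)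
  qed
  ultimately show ?case
    using Cons.prems by (simp add: count_image_mset_set)
qed

lemma has_bochner_integral_finite_range:
  assumes "finite_measure M" "finite S" "\<And>\<omega>. \<omega> \<in> space M \<Longrightarrow> X \<omega> \<in> S"
    and "\<And>x. x \<in> S \<Longrightarrow> {\<omega> \<in> space M. X \<omega> = x} \<in> sets M"
  shows "has_bochner_integral M (\<lambda>\<omega>. g (X \<omega>) :: real) (\<Sum>x\<in>S. measure M {\<omega> \<in> space M. X \<omega> = x} * g x)"
proof -
  interpret finite_measure M
    by fact
  have "has_bochner_integral M (\<lambda>\<omega>. \<Sum>x\<in>S. indicator {\<omega> \<in> space M. X \<omega> = x} \<omega> * g x)
      (\<Sum>x\<in>S. measure M {\<omega> \<in> space M. X \<omega> = x} * g x)"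
    using assms(4)
    by (intro has_bochner_integral_sum has_bochner_integral_mult_left has_bochner_integral_real_indicator)
      (auto simp: less_top[symmetric])
  moreover have "(\<Sum>x\<in>S. indicator {\<omega> \<in> space M. X \<omega> = x} \<omega> * g x) = g (X \<omega>)" if "\<omega> \<in> space M" for \<omega>
  proof -
    have "(\<Sum>x\<in>S. indicator {\<omega> \<in> space M. X \<omega> = x} \<omega> * g x) = (\<Sum>x\<in>S. if X \<omega> = x then g x else 0)"
      using that by (intro sum.cong refl) (auto simp: indicator_def)
    also have "\<dots> = g (X \<omega>)"
      using assms(2) assms(3)[OF that] by simp
    finally show ?thesis .
  qed
  ultimately show ?thesis
    by (simp cong: has_bochner_integral_cong)
qed

lemma integral_indicator_Collect:
  "(\<integral>\<omega>. (indicator {\<omega> \<in> space M. P \<omega>} \<omega> :: real) \<partial>M) = measure M {\<omega> \<in> space M. P \<omega>}"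
proof -
  have "{\<omega> \<in> space M. P \<omega>} \<inter> space M = {\<omega> \<in> space M. P \<omega>}"
    by auto
  then show ?thesis
    using Bochner_Integration.integral_indicator[of M "{\<omega> \<in> space M. P \<omega>}"] by simp
qed

lemma measure_finite_range:
  assumes "finite_measure M" "finite S" "\<And>\<omega>. \<omega> \<in> space M \<Longrightarrow> X \<omega> \<in> S"
    and "\<And>x. x \<in> S \<Longrightarrow> {\<omega> \<in> space M. X \<omega> = x} \<in> sets M"
  shows "measure M {\<omega> \<in> space M. \<phi> (X \<omega>)} = (\<Sum>x\<in>S. measure M {\<omega> \<in> space M. X \<omega> = x} * of_bool (\<phi> x))"
proof -
  have "(\<Sum>x\<in>S. measure M {\<omega> \<in> space M. X \<omega> = x} * of_bool (\<phi> x)) = (\<integral>\<omega>. of_bool (\<phi> (X \<omega>)) \<partial>M)"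
    using has_bochner_integral_integral_eq[OF has_bochner_integral_finite_range[OF assms, of "\<lambda>x. of_bool (\<phi> x)"]]
    by simp
  also have "\<dots> = (\<integral>\<omega>. indicator {\<omega> \<in> space M. \<phi> (X \<omega>)} \<omega> \<partial>M)"
    by (intro Bochner_Integration.integral_cong refl) (simp add: indicator_def)
  also have "\<dots> = measure M {\<omega> \<in> space M. \<phi> (X \<omega>)}"
    by (rule integral_indicator_Collect)
  finally show ?thesis ..
qed

text \<open>A function measurable with respect to the algebra generated by \<open>X\<close> is constant on the level sets of \<open>X\<close>.\<close>

lemma real_cond_exp_vimage_atom:
  fixes X :: "'a \<Rightarrow> 'b"
  assumes "prob_space M" and X: "X \<in> M \<rightarrow>\<^sub>M count_space UNIV" and f: "integrable M f"
    and \<omega>: "\<omega> \<in> space M"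
  defines "A \<equiv> {\<omega>' \<in> space M. X \<omega>' = X \<omega>}"
  shows "real_cond_exp M (vimage_algebra (space M) X (count_space UNIV)) f \<omega> * measure M A =
    (\<integral>\<omega>'. indicator A \<omega>' * f \<omega>' \<partial>M)"
proof -
  define F where "F = vimage_algebra (space M) X (count_space UNIV)"
  interpret prob_space M
    by fact
  have sets_F: "sets F = {X -` S \<inter> space M | S. True}"
    unfolding F_def by (subst sets_vimage_algebra2) auto
  have sub: "subalgebra M F"
    using measurable_sets[OF X] sets_F by (auto simp: subalgebra_def F_def)
  interpret sigma_finite_subalgebra M F
    using finite_measure_subalgebra_is_sigma_finite[of M F] sub finite_measure_axioms
    by (simp add: finite_measure_subalgebra_def finite_measure_subalgebra_axioms_def)
  define g where "g = real_cond_exp M F f"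
  have A_F: "A \<in> sets F"
    unfolding sets_F A_def by (auto intro!: exI[of _ "{X \<omega>}"])
  have "g -` {g \<omega>} \<inter> space F \<in> sets F"
    unfolding g_def by (intro measurable_sets[OF borel_measurable_cond_exp]) auto
  then obtain S where S: "g -` {g \<omega>} \<inter> space M = X -` S \<inter> space M"
    unfolding sets_F by (auto simp: F_def)
  have const: "g \<omega>' = g \<omega>" if "\<omega>' \<in> A" for \<omega>'
  proof -
    have "\<omega> \<in> X -` S \<inter> space M"
      using \<omega> unfolding S[symmetric] by simp
    then have "\<omega>' \<in> X -` S \<inter> space M"
      using that by (simp add: A_def)
    then show ?thesis
      unfolding S[symmetric] by simp
  qed
  have "(\<integral>\<omega>'. indicator A \<omega>' * f \<omega>' \<partial>M) = (\<integral>\<omega>'. indicator A \<omega>' * g \<omega>' \<partial>M)"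
    using real_cond_exp_intA[OF f A_F] by (simp add: g_def set_lebesgue_integral_def)
  also have "\<dots> = (\<integral>\<omega>'. g \<omega> * indicator A \<omega>' \<partial>M)"
    using const by (intro Bochner_Integration.integral_cong refl) (auto simp: indicator_def)
  also have "\<dots> = g \<omega> * measure M A"
    unfolding A_def by (simp only: integral_mult_right_zero integral_indicator_Collect)
  finally show ?thesis
    by (simp add: g_def F_def)
qed

text \<open>Both summands of the weight recursion are nonnegative and N - k \<alpha> > 0, so a
  vanishing left side forces each summand to vanish. This makes the cancellation of V N k against
  the denominator of the predictor valid even where x / 0 = 0 is used.\<close>

lemma gibbs_weights_V_Suc_eq_0:
  assumes V: "gibbs_weights \<alpha> V" and "1 \<le> k" "k \<le> N" "V N k = 0"
  shows "V (Suc N) k = 0"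
proof -
  have \<alpha>: "\<alpha> < 1"
    using V unfolding gibbs_weights_def by blast
  have V': "0 \<le> V n k \<and> V n k = (real n - real k * \<alpha>) * V (n + 1) k + V (n + 1) (k + 1)"
    if "1 \<le> k" "k \<le> n" for n k
    using V that unfolding gibbs_weights_def by blast
  note eq = V'[OF assms(2,3), THEN conjunct2]
  have nonneg: "0 \<le> V (N + 1) k" "0 \<le> V (N + 1) (k + 1)"
    using V'[of k "N + 1"] V'[of "k + 1" "N + 1"] assms(2,3) by simp_all
  have "real k * \<alpha> < real k"
    using \<alpha> \<open>1 \<le> k\<close> by simp
  then have pos: "0 < real N - real k * \<alpha>"
    using \<open>k \<le> N\<close> by simp
  have "(real N - real k * \<alpha>) * V (N + 1) k = 0"
    using eq nonneg(2) mult_nonneg_nonneg[OF less_imp_le[OF pos] nonneg(1)] \<open>V N k = 0\<close> by linarith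
  then show ?thesis
    using pos by simp
qed

lemma block_weight_pos:
  assumes "\<alpha> < 1"
  shows "0 < block_weight \<alpha> p"
  unfolding block_weight_def using assms by (intro prod_pos) (simp add: pochhammer_pos)

lemma card_partition_bounds:
  assumes q: "partition_on {1..N} q" and "1 \<le> N"
  shows "1 \<le> card q" "card q \<le> N"
proof -
  have "q \<noteq> {}"
    using q \<open>1 \<le> N\<close> by (auto simp: partition_on_def)
  then show "1 \<le> card q"
    using finite_partition_on_atLeastAtMost[OF q] by (simp add: Suc_le_eq card_gt_0_iff)
  have "(\<Sum>A\<in>q. 1) \<le> (\<Sum>A\<in>q. card A)"
    using partition_on_atLeastAtMostD(5)[OF q] by (intro sum_mono) simp
  then show "card q \<le> N"
    by (simp add: sum_card_partition[OF q])
qed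

section \<open>Gibbs partitions\<close>

definition partitions :: "nat \<Rightarrow> nat set set set" where
  "partitions N = {q. partition_on {1..N} q}"

text \<open>The random probability as a function of the partition of {1..N} alone: the index j + k
  is recovered as \<open>card q\<close>.\<close>

definition predictor ::
  "real \<Rightarrow> (nat \<Rightarrow> nat \<Rightarrow> real) \<Rightarrow> nat \<Rightarrow> nat \<Rightarrow> nat \<Rightarrow> nat set set \<Rightarrow> real" where
  "predictor \<alpha> V n N l q =
     V (Suc N) (card q) / V N (card q) * (real l - \<alpha>) * real (count (new_size_mset n q) l)"

lemma finite_partitions: "finite (partitions N)"
  unfolding partitions_def by (rule finitely_many_partition_on) simp

lemma sum_partitions_eq_sum_extensions:
  "(\<Sum>q\<in>partitions N. f q * of_bool (restr n q = p)) = (\<Sum>q\<in>extensions p n N. f q :: real)"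
proof -
  have "(\<Sum>q\<in>extensions p n N. f q) = (\<Sum>q\<in>extensions p n N. f q * of_bool (restr n q = p))"
    by (intro sum.cong refl) (simp add: extensions_def)
  also have "\<dots> = (\<Sum>q\<in>partitions N. f q * of_bool (restr n q = p))"
    by (intro sum.mono_neutral_left finite_partitions) (auto simp: extensions_def partitions_def)
  finally show ?thesis ..
qed

locale gibbs =
  fixes M :: "'a measure" and \<alpha> :: real and V :: "nat \<Rightarrow> nat \<Rightarrow> real" and R :: "'a \<Rightarrow> nat set set"
  assumes gibbs: "gibbs_partition M \<alpha> V R"
begin

sublocale prob_space M
  using gibbs by (simp add: gibbs_partition_def)

lemma weights: "gibbs_weights \<alpha> V"
  using gibbs by (simp add: gibbs_partition_def)

lemma alpha_less_1: "\<alpha> < 1"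
  using weights unfolding gibbs_weights_def by blast

lemma measurable_restr: "(\<lambda>\<omega>. restr n (R \<omega>)) \<in> M \<rightarrow>\<^sub>M count_space UNIV"
  using gibbs by (simp add: gibbs_partition_def)

lemma sets_restr: "{\<omega> \<in> space M. P (restr n (R \<omega>))} \<in> sets M"
proof -
  have "(\<lambda>\<omega>. restr n (R \<omega>)) -` {q. P q} \<inter> space M \<in> sets M"
    by (rule measurable_sets[OF measurable_restr]) simp
  also have "(\<lambda>\<omega>. restr n (R \<omega>)) -` {q. P q} \<inter> space M = {\<omega> \<in> space M. P (restr n (R \<omega>))}"
    by auto
  finally show ?thesis .
qed

lemma restr_in_partitions:
  assumes "\<omega> \<in> space M"
  shows "restr N (R \<omega>) \<in> partitions N"
proof -
  have "partition_on {1..} (R \<omega>)"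
    using gibbs assms unfolding gibbs_partition_def by blast
  then show ?thesis
    unfolding partitions_def mem_Collect_eq by (rule partition_on_restr) auto
qed

lemma measure_restr:
  assumes "1 \<le> N" "partition_on {1..N} q"
  shows "measure M {\<omega> \<in> space M. restr N (R \<omega>) = q} = V N (card q) * block_weight \<alpha> q"
  using gibbs assms unfolding gibbs_partition_def block_weight_def by blast

lemma has_bochner_integral_restr:
  "has_bochner_integral M (\<lambda>\<omega>. g (restr N (R \<omega>)) :: real)
    (\<Sum>q\<in>partitions N. measure M {\<omega> \<in> space M. restr N (R \<omega>) = q} * g q)"
  by (intro has_bochner_integral_finite_range finite_measure_axioms finite_partitions
      restr_in_partitions sets_restr)

lemma measure_restr_Collect:
  "measure M {\<omega> \<in> space M. \<phi> (restr N (R \<omega>))} =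
    (\<Sum>q\<in>partitions N. measure M {\<omega> \<in> space M. restr N (R \<omega>) = q} * of_bool (\<phi> q))"
  by (intro measure_finite_range finite_measure_axioms finite_partitions
      restr_in_partitions sets_restr)

lemma cond_exp_restr_atom:
  assumes "integrable M f" "\<omega> \<in> space M"
  shows "cond_exp_restr M R n f \<omega> * measure M {\<omega>' \<in> space M. restr n (R \<omega>') = restr n (R \<omega>)} =
    (\<integral>\<omega>'. indicator {\<omega>' \<in> space M. restr n (R \<omega>') = restr n (R \<omega>)} \<omega>' * f \<omega>' \<partial>M)"
  unfolding cond_exp_restr_def
  by (intro real_cond_exp_vimage_atom prob_space_axioms measurable_restr assms)

text \<open>There are finitely many atoms, so the null ones can be discarded together. On the others
  a conditional expectation is pinned down at every point by its average.\<close>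

lemma AE_restr_measure_pos:
  "AE \<omega> in M. 0 < measure M {\<omega>' \<in> space M. restr N (R \<omega>') = restr N (R \<omega>)}"
proof -
  have "AE \<omega> in M. restr N (R \<omega>) = q \<longrightarrow> 0 < measure M {\<omega>' \<in> space M. restr N (R \<omega>') = q}" for q
  proof (cases "measure M {\<omega>' \<in> space M. restr N (R \<omega>') = q} = 0")
    case True
    then have "{\<omega>' \<in> space M. restr N (R \<omega>') = q} \<in> null_sets M"
      using sets_restr[of "\<lambda>r. r = q" N] by (simp add: null_sets_def emeasure_eq_measure)
    from AE_not_in[OF this] show ?thesis
      by (rule AE_mp) (rule AE_I2, simp)
  next
    case False
    then show ?thesis
      by (simp add: zero_less_measure_iff)
  qed
  then have "AE \<omega> in M. \<forall>q\<in>partitions N. restr N (R \<omega>) = q \<longrightarrow>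
      0 < measure M {\<omega>' \<in> space M. restr N (R \<omega>') = q}"
    by (intro AE_finite_allI finite_partitions)
  then show ?thesis
    by (rule AE_mp) (rule AE_I2, use restr_in_partitions in blast)
qed

lemma next_in_new_species_Int_atom:
  assumes q: "partition_on {1..n + m} q"
  shows "next_in_new_species M R n m l \<inter> {\<omega> \<in> space M. restr (n + m) (R \<omega>) = q} =
    {\<omega> \<in> space M. restr (n + m) (restr (Suc (n + m)) (R \<omega>)) = q \<and>
      (\<exists>A\<in>new_blocks n q. card A = l \<and> insert (Suc (n + m)) A \<in> restr (Suc (n + m)) (R \<omega>))}"
  by (auto simp: next_in_new_species_def restr_restr)

lemma sets_next_in_new_species: "next_in_new_species M R n m l \<in> sets M"
proof -
  have "{\<omega> \<in> space M. \<exists>A\<in>new_blocks n (restr (n + m) (restr (n + m + 1) (R \<omega>))).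
      card A = l \<and> insert (n + m + 1) A \<in> restr (n + m + 1) (R \<omega>)} \<in> sets M"
    by (rule sets_restr)
  then show ?thesis
    by (simp add: next_in_new_species_def restr_restr)
qed

text \<open>Inside the atom of q the event consists of the extensions that join N + 1 to a new block
  of size l. Each keeps the number of blocks and multiplies the weight by l - \<alpha>.\<close>

lemma measure_next_in_new_species_Int_atom:
  assumes q: "partition_on {1..n + m} q"
  shows "measure M (next_in_new_species M R n m l \<inter> {\<omega> \<in> space M. restr (n + m) (R \<omega>) = q}) =
    V (Suc (n + m)) (card q) * block_weight \<alpha> q * (real l - \<alpha>) * real (count (new_size_mset n q) l)"
proof -
  define N where "N = n + m"
  define \<psi> where "\<psi> r \<longleftrightarrow> (\<exists>A\<in>new_blocks n q. card A = l \<and> insert (Suc N) A \<in> r)" for r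
  define P where "P r = measure M {\<omega> \<in> space M. restr (Suc N) (R \<omega>) = r}" for r
  have q': "partition_on {1..N} q"
    using q by (simp add: N_def)
  have fin: "finite q"
    using finite_partition_on_atLeastAtMost[OF q'] .
  \<comment> \<open>The block of N + 1 in \<open>extend N q B\<close> is
    \<open>insert (Suc N) B\<close>, so it identifies B.\<close>
  have notin: "insert (Suc N) A \<in> extend N q B \<longleftrightarrow> A = B" if "A \<in> q" "B \<in> insert {} q" for A B
  proof -
    have "Suc N \<notin> A" "Suc N \<notin> B"
      using partition_on_atLeastAtMostD(4)[OF q'] that by auto
    then show ?thesis
      using extend_notin[OF q', of A] by (simp add: extend_def insert_ident)
  qed
  have new: "new_blocks n q \<subseteq> q" "{} \<notin> new_blocks n q"
    using partition_onD3[OF q'] by (auto simp: new_blocks_def)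
  have \<psi>: "\<psi> (extend N q B) \<longleftrightarrow> B \<in> new_blocks n q \<and> card B = l" if "B \<in> insert {} q" for B
    unfolding \<psi>_def using new(1) notin[OF _ that] by blast
  have P: "P (extend N q A) = V (Suc N) (card q) * block_weight \<alpha> q * (real (card A) - \<alpha>)" if "A \<in> q" for A
    using partition_on_extend[OF q', of A] that
    by (simp add: P_def measure_restr card_extend[OF q' that] block_weight_extend[OF q' that])
  have "measure M (next_in_new_species M R n m l \<inter> {\<omega> \<in> space M. restr N (R \<omega>) = q}) =
      measure M {\<omega> \<in> space M. restr N (restr (Suc N) (R \<omega>)) = q \<and> \<psi> (restr (Suc N) (R \<omega>))}"
    unfolding N_def next_in_new_species_Int_atom[OF q] \<psi>_def ..
  also have "\<dots> = (\<Sum>r\<in>partitions (Suc N). (P r * of_bool (\<psi> r)) * of_bool (restr N r = q))"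
    unfolding measure_restr_Collect[of "\<lambda>r. restr N r = q \<and> \<psi> r"] P_def
    by (intro sum.cong refl) (simp add: of_bool_conj)
  also have "\<dots> = (\<Sum>r\<in>extensions q N (Suc N). P r * of_bool (\<psi> r))"
    by (rule sum_partitions_eq_sum_extensions)
  also have "\<dots> = (\<Sum>A\<in>q. P (extend N q A) * of_bool (\<psi> (extend N q A)))"
    using new(2) by (simp add: sum_extensions_Suc extensions_self[OF q'] \<psi>)
  also have "\<dots> = (\<Sum>A\<in>q. V (Suc N) (card q) * block_weight \<alpha> q * (real l - \<alpha>) *
      of_bool (A \<in> new_blocks n q \<and> card A = l))"
    by (intro sum.cong refl) (auto simp: P \<psi>)
  also have "\<dots> = V (Suc N) (card q) * block_weight \<alpha> q * (real l - \<alpha>) *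
      real (card {A \<in> new_blocks n q. card A = l})"
  proof -
    have "{A \<in> q. A \<in> new_blocks n q \<and> card A = l} = {A \<in> new_blocks n q. card A = l}"
      using new(1) by auto
    then show ?thesis
      using fin by (simp add: sum_distrib_left[symmetric] Int_def)
  qed
  also have "card {A \<in> new_blocks n q. card A = l} = count (new_size_mset n q) l"
    using finite_subset[OF new(1) fin] by (simp add: new_size_mset_def count_image_mset_set)
  finally show ?thesis
    by (simp add: N_def)
qed

lemma cond_exp_next_in_new_species:
  assumes "1 \<le> n" and \<omega>: "\<omega> \<in> space M"
    and pos: "0 < measure M {\<omega>' \<in> space M. restr (n + m) (R \<omega>') = restr (n + m) (R \<omega>)}"
  shows "cond_exp_restr M R (n + m) (indicator (next_in_new_species M R n m l)) \<omega> =
    predictor \<alpha> V n (n + m) l (restr (n + m) (R \<omega>))"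
proof -
  define q where "q = restr (n + m) (R \<omega>)"
  define E where "E = next_in_new_species M R n m l"
  define A where "A = {\<omega>' \<in> space M. restr (n + m) (R \<omega>') = q}"
  have q: "partition_on {1..n + m} q"
    using restr_in_partitions[OF \<omega>] by (simp add: partitions_def q_def)
  have sets: "E \<in> sets M" "A \<in> sets M"
    unfolding E_def A_def by (rule sets_next_in_new_species, rule sets_restr)
  have "integrable M (indicator E :: 'a \<Rightarrow> real)"
    using sets(1) by (simp add: less_top[symmetric])
  then have "cond_exp_restr M R (n + m) (indicator E) \<omega> * measure M A =
      (\<integral>\<omega>'. indicator A \<omega>' * indicator E \<omega>' \<partial>M)"
    unfolding A_def q_def using \<omega> by (rule cond_exp_restr_atom)
  also have "(\<lambda>\<omega>'. indicator A \<omega>' * indicator E \<omega>' :: real) = indicator (E \<inter> A)"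
    by (auto simp: indicator_def)
  also have "(\<integral>\<omega>'. indicator (E \<inter> A) \<omega>' \<partial>M) = measure M (E \<inter> A)"
    using sets.sets_into_space[OF sets(2)]
    by (subst Bochner_Integration.integral_indicator) (auto intro!: arg_cong[of _ _ "measure M"])
  finally have "cond_exp_restr M R (n + m) (indicator E) \<omega> * (V (n + m) (card q) * block_weight \<alpha> q) =
      V (Suc (n + m)) (card q) * block_weight \<alpha> q * (real l - \<alpha>) * real (count (new_size_mset n q) l)"
    using measure_restr[OF _ q] \<open>1 \<le> n\<close>
    unfolding E_def A_def measure_next_in_new_species_Int_atom[OF q] by simp
  then have "(cond_exp_restr M R (n + m) (indicator E) \<omega> * V (n + m) (card q)) * block_weight \<alpha> q =
      (V (Suc (n + m)) (card q) * (real l - \<alpha>) * real (count (new_size_mset n q) l)) * block_weight \<alpha> q"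
    by (simp only: mult_ac)
  then have "cond_exp_restr M R (n + m) (indicator E) \<omega> * V (n + m) (card q) =
      V (Suc (n + m)) (card q) * (real l - \<alpha>) * real (count (new_size_mset n q) l)"
    using block_weight_pos[OF alpha_less_1, of q] by simp
  \<comment> \<open>The measure of the atom is a multiple of this weight, so a non-null atom permits
    the division.\<close>
  moreover have "V (n + m) (card q) \<noteq> 0"
    using pos measure_restr[OF _ q] \<open>1 \<le> n\<close> unfolding q_def[symmetric] by auto
  ultimately show ?thesis
    unfolding E_def[symmetric] q_def[symmetric] predictor_def
    by (simp only: times_divide_eq_left nonzero_eq_divide_eq not_False_eq_True)
qed

end

section \<open>Randomly ordered new blocks and the estimator\<close>

lemma sum_nth_eq_count: "(\<Sum>i<length s. if s ! i = l then 1 else 0) = count (mset s) l"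
proof (induction s)
  case (Cons x s)
  then show ?case
    unfolding list.size by (simp add: sum.lessThan_Suc_shift del: sum.lessThan_Suc)
qed simp

locale gibbs_order = gibbs +
  fixes n m :: nat and B :: "'a \<Rightarrow> nat set list"
  assumes n: "1 \<le> n" and order: "exchangeable_order M R n m B"
begin

lemma order_in_permutations:
  "\<omega> \<in> space M \<Longrightarrow> B \<omega> \<in> permutations_of_set (new_blocks n (restr (n + m) (R \<omega>)))"
  using order unfolding exchangeable_order_def by blast

lemma measure_order:
  assumes "partition_on {1..n + m} q" "bs \<in> permutations_of_set (new_blocks n q)"
  shows "measure M {\<omega> \<in> space M. restr (n + m) (R \<omega>) = q \<and> B \<omega> = bs} =
    measure M {\<omega> \<in> space M. restr (n + m) (R \<omega>) = q} / fact (card (new_blocks n q))"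
proof -
  have "\<forall>N\<ge>n + m. \<forall>q. partition_on {1..N} q \<longrightarrow>
      (\<forall>bs\<in>permutations_of_set (new_blocks n (restr (n + m) q)).
        measure M {\<omega> \<in> space M. restr N (R \<omega>) = q \<and> B \<omega> = bs} =
          measure M {\<omega> \<in> space M. restr N (R \<omega>) = q} / fact (card (new_blocks n (restr (n + m) q))))"
    using order unfolding exchangeable_order_def by (elim conjE)
  from this[rule_format, OF le_refl assms(1), of bs] show ?thesis
    using assms(2) unfolding restr_id[OF assms(1)] .
qed

lemma sets_order: "{\<omega> \<in> space M. restr (n + m) (R \<omega>) = q \<and> B \<omega> = bs} \<in> sets M"
proof -
  have "B \<in> M \<rightarrow>\<^sub>M count_space UNIV"
    using order unfolding exchangeable_order_def by blast
  then have "B -` {bs} \<inter> space M \<in> sets M"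
    by (rule measurable_sets) simp
  moreover have "{\<omega> \<in> space M. restr (n + m) (R \<omega>) = q} \<in> sets M"
    by (rule sets_restr)
  ultimately have "(B -` {bs} \<inter> space M) \<inter> {\<omega> \<in> space M. restr (n + m) (R \<omega>) = q} \<in> sets M"
    by (rule sets.Int)
  also have "(B -` {bs} \<inter> space M) \<inter> {\<omega> \<in> space M. restr (n + m) (R \<omega>) = q} =
      {\<omega> \<in> space M. restr (n + m) (R \<omega>) = q \<and> B \<omega> = bs}"
    by auto
  finally show ?thesis .
qed

text \<open>\<open>B \<omega>\<close> lists each new block once and frequencies ignore the order, so
  the randomness of the order drops out of the estimator.\<close>

lemma freq_count_new_sizes:
  assumes "\<omega> \<in> space M"
  shows "freq_count l (new_sizes R n m B \<omega>) = count (new_size_mset n (restr (n + m) (R \<omega>))) l"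
proof -
  define q where "q = restr (n + m) (R \<omega>)"
  have B: "B \<omega> \<in> permutations_of_set (new_blocks n q)"
    using order_in_permutations[OF assms] by (simp add: q_def)
  then have "set (B \<omega>) = new_blocks n q" "distinct (B \<omega>)"
    by (simp_all add: permutations_of_set_def)
  then have "mset (B \<omega>) = mset_set (new_blocks n q)" "length (B \<omega>) = card (new_blocks n q)"
    by (metis mset_set_set, metis distinct_card)
  then have "mset (map card (B \<omega>)) = new_size_mset n q" "length (map card (B \<omega>)) = card (new_blocks n q)"
    by (simp_all add: new_size_mset_def)
  then show ?thesis
    using sum_nth_eq_count[of "map card (B \<omega>)" l]
    by (simp only: freq_count_def new_sizes_def prod.case flip: q_def)
qed

lemma P_new_new_sizes:
  assumes \<omega>: "\<omega> \<in> space M"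
  shows "P_new \<alpha> V n m l (card (restr n (R \<omega>))) (new_sizes R n m B \<omega>) =
    predictor \<alpha> V n (n + m) l (restr (n + m) (R \<omega>))"
proof -
  define q where "q = restr (n + m) (R \<omega>)"
  have q: "partition_on {1..n + m} q"
    using restr_in_partitions[OF \<omega>] by (simp add: partitions_def q_def)
  have "card q = card (restr n (R \<omega>)) + card (new_blocks n q)"
    using card_eq_restr_plus_new[OF q, of n] restr_restr[of n "n + m" "R \<omega>"] by (simp add: q_def)
  moreover obtain s where s: "new_sizes R n m B \<omega> = (s, card (new_blocks n q))"
    by (simp add: new_sizes_def q_def)
  moreover have "freq_count l (s, card (new_blocks n q)) = count (new_size_mset n q) l"
    using freq_count_new_sizes[OF \<omega>, of l] by (simp add: s q_def)
  ultimately show ?thesis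
    by (simp add: P_new_def predictor_def flip: q_def)
qed

lemma P_new_rv_eq_predictor:
  "\<omega> \<in> space M \<Longrightarrow> P_new_rv \<alpha> V R n m l B \<omega> = predictor \<alpha> V n (n + m) l (restr (n + m) (R \<omega>))"
  unfolding P_new_rv_def by (rule P_new_new_sizes)

lemma AE_cond_exp_next_in_new_species:
  "AE \<omega> in M. cond_exp_restr M R (n + m) (indicator (next_in_new_species M R n m l)) \<omega> =
     P_new_rv \<alpha> V R n m l B \<omega>"
  using AE_restr_measure_pos[of "n + m"]
  by (rule AE_mp)
    (rule AE_I2, use cond_exp_next_in_new_species[OF n] P_new_rv_eq_predictor in simp)

lemma integrable_P_new_rv: "integrable M (P_new_rv \<alpha> V R n m l B)"
  using has_bochner_integral_restr[of "predictor \<alpha> V n (n + m) l" "n + m"]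
  by (simp add: has_bochner_integral_iff P_new_rv_eq_predictor cong: Bochner_Integration.integrable_cong)

lemma integral_P_new_rv_atom:
  "(\<integral>\<omega>. indicator {\<omega> \<in> space M. restr n (R \<omega>) = p} \<omega> * P_new_rv \<alpha> V R n m l B \<omega> \<partial>M) =
    (\<Sum>q\<in>extensions p n (n + m). measure M {\<omega> \<in> space M. restr (n + m) (R \<omega>) = q} *
      predictor \<alpha> V n (n + m) l q)"
proof -
  define g where "g q = predictor \<alpha> V n (n + m) l q * of_bool (restr n q = p)" for q
  have "(\<integral>\<omega>. indicator {\<omega> \<in> space M. restr n (R \<omega>) = p} \<omega> * P_new_rv \<alpha> V R n m l B \<omega> \<partial>M) =
      (\<integral>\<omega>. g (restr (n + m) (R \<omega>)) \<partial>M)"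
    by (intro Bochner_Integration.integral_cong refl)
      (simp add: P_new_rv_eq_predictor g_def restr_restr indicator_def)
  also have "\<dots> = (\<Sum>q\<in>partitions (n + m). measure M {\<omega> \<in> space M. restr (n + m) (R \<omega>) = q} * g q)"
    by (rule has_bochner_integral_integral_eq[OF has_bochner_integral_restr])
  also have "\<dots> = (\<Sum>q\<in>extensions p n (n + m). measure M {\<omega> \<in> space M. restr (n + m) (R \<omega>) = q} *
      predictor \<alpha> V n (n + m) l q)"
    unfolding g_def mult.assoc[symmetric] by (rule sum_partitions_eq_sum_extensions)
  finally show ?thesis .
qed

text \<open>After cancelling V(n+m, j+k), the summand of an extension with k new blocks is V(n+m+1,
  j+k) times a term free of V. Sorting by k reduces the sum to \<open>growth_count\<close>.\<close>

lemma integral_predictor: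
  assumes p: "partition_on {1..n} p" and l: "l \<in> {1..m}"
  shows "(\<Sum>q\<in>extensions p n (n + m). measure M {\<omega> \<in> space M. restr (n + m) (R \<omega>) = q} *
      predictor \<alpha> V n (n + m) l q) =
    block_weight \<alpha> p * (real l - \<alpha>) *
      (\<Sum>k = 1..1 + (m - l). V (n + m + 1) (card p + k) * real (m choose l) * pochhammer (1 - \<alpha>) (l - 1) *
        stirling_noncentral \<alpha> (- (real n - real (card p) * \<alpha>)) (m - l) (k - 1))"
proof -
  define v where "v k = V (n + m + 1) (card p + k)" for k
  \<comment> \<open>Large enough for the number of new blocks of every extension and for the range
    of the final sum; the surplus terms vanish at the end.\<close>
  define I where "I = {..1 + m} \<union> (\<lambda>q. size (new_size_mset n q)) ` extensions p n (n + m)"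
  define S where "S k = real (m choose l) * pochhammer (1 - \<alpha>) (l - 1) *
    stirling_noncentral \<alpha> (- (real n - real (card p) * \<alpha>)) (m - l) (k - 1)" for k
  have fin: "finite I"
    by (simp add: I_def finite_extensions)
  have term_eq: "measure M {\<omega> \<in> space M. restr (n + m) (R \<omega>) = q} * predictor \<alpha> V n (n + m) l q =
      (\<Sum>k\<in>I. (real l - \<alpha>) * v k * (block_weight \<alpha> q * (of_bool (size (new_size_mset n q) = k) *
        real (count (new_size_mset n q) l))))"
    if "q \<in> extensions p n (n + m)" for q
  proof -
    have q: "partition_on {1..n + m} q" and qp: "restr n q = p"
      using that by (auto simp: extensions_def)
    define k where "k = size (new_size_mset n q)"
    have card: "card q = card p + k"
      using card_eq_restr_plus_new[OF q, of n] by (simp add: qp k_def size_new_size_mset)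
    \<comment> \<open>The case in which the quotient takes the default value 0: the product must
      still equal \<open>v k\<close>.\<close>
    have "V (n + m) (card q) = 0 \<Longrightarrow> V (Suc (n + m)) (card q) = 0"
      using card_partition_bounds[OF q] n by (intro gibbs_weights_V_Suc_eq_0[OF weights]) simp_all
    then have v: "V (n + m) (card q) * (V (Suc (n + m)) (card q) / V (n + m) (card q)) = v k"
      by (auto simp: v_def card)
    have P: "measure M {\<omega> \<in> space M. restr (n + m) (R \<omega>) = q} = V (n + m) (card q) * block_weight \<alpha> q"
      using n by (intro measure_restr[OF _ q]) simp
    have "measure M {\<omega> \<in> space M. restr (n + m) (R \<omega>) = q} * predictor \<alpha> V n (n + m) l q =
        (V (n + m) (card q) * (V (Suc (n + m)) (card q) / V (n + m) (card q))) *
        ((real l - \<alpha>) * (block_weight \<alpha> q * real (count (new_size_mset n q) l)))"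
      unfolding P predictor_def by (simp only: mult_ac)
    also have "\<dots> = (real l - \<alpha>) * v k * (block_weight \<alpha> q * real (count (new_size_mset n q) l))"
      unfolding v by (simp only: mult_ac)
    also have "\<dots> = (\<Sum>k'\<in>I. if k = k' then (real l - \<alpha>) * v k' *
        (block_weight \<alpha> q * real (count (new_size_mset n q) l)) else 0)"
      using that fin by (subst sum.delta') (auto simp: I_def k_def)
    also have "\<dots> = (\<Sum>k'\<in>I. (real l - \<alpha>) * v k' * (block_weight \<alpha> q * (of_bool (k = k') *
        real (count (new_size_mset n q) l))))"
      by (intro sum.cong refl) simp
    finally show ?thesis
      by (simp only: k_def)
  qed
  have growth: "growth \<alpha> (card p) n m (\<lambda>\<mu>. of_bool (size \<mu> = k) * real (count \<mu> l)) =
      of_bool (k \<noteq> 0) * S k" for k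
  proof (cases k)
    case 0
    then show ?thesis
      by (simp only: growth_count_size_0) simp
  next
    case (Suc k')
    obtain l' where "l = Suc l'"
      using l by (cases l) auto
    then show ?thesis
      by (simp only: Suc growth_count S_def) simp
  qed
  have "(\<Sum>q\<in>extensions p n (n + m). measure M {\<omega> \<in> space M. restr (n + m) (R \<omega>) = q} *
      predictor \<alpha> V n (n + m) l q) =
    (\<Sum>q\<in>extensions p n (n + m). \<Sum>k\<in>I. (real l - \<alpha>) * v k * (block_weight \<alpha> q *
      (of_bool (size (new_size_mset n q) = k) * real (count (new_size_mset n q) l))))"
    by (intro sum.cong refl term_eq)
  also have "\<dots> = (\<Sum>k\<in>I. (real l - \<alpha>) * v k * (block_weight \<alpha> p * (of_bool (k \<noteq> 0) * S k)))"
    unfolding growth[symmetric] sum_extensions_eq_growth[OF p, symmetric]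
    by (subst sum.swap) (simp only: sum_distrib_left)
  also have "\<dots> = (\<Sum>k = 1..1 + (m - l). (real l - \<alpha>) * v k * (block_weight \<alpha> p * (of_bool (k \<noteq> 0) * S k)))"
  proof (rule sum.mono_neutral_right[OF fin])
    show "{1..1 + (m - l)} \<subseteq> I"
      by (auto simp: I_def)
    show "\<forall>k\<in>I - {1..1 + (m - l)}. (real l - \<alpha>) * v k * (block_weight \<alpha> p * (of_bool (k \<noteq> 0) * S k)) = 0"
    proof
      fix k
      assume "k \<in> I - {1..1 + (m - l)}"
      \<comment> \<open>Either there is no new block at all, or more than m - l further blocks would
        have to be formed from m - l elements.\<close>
      then have "k = 0 \<or> m - l < k - 1"
        by auto
      then show "(real l - \<alpha>) * v k * (block_weight \<alpha> p * (of_bool (k \<noteq> 0) * S k)) = 0"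
        by (auto simp: S_def stirling_noncentral_eq_0)
    qed
  qed
  also have "\<dots> = block_weight \<alpha> p * (real l - \<alpha>) * (\<Sum>k = 1..1 + (m - l). v k * S k)"
    unfolding sum_distrib_left by (intro sum.cong refl) (auto simp: algebra_simps)
  finally show ?thesis
    by (simp only: v_def S_def mult.assoc)
qed

section \<open>The conditional law of the ordered sizes\<close>

lemma measure_new_sizes:
  assumes p: "partition_on {1..n} p"
  shows "measure M {\<omega> \<in> space M. restr n (R \<omega>) = p \<and> new_sizes R n m B \<omega> = (s, k)} =
    block_weight \<alpha> p * growth \<alpha> (card p) n m
      (\<lambda>\<mu>. of_bool (size \<mu> = k) * V (n + m) (card p + k) * real (count_orders s \<mu>) / fact k)"
proof -
  \<comment> \<open>The partition of {1..n+m} together with the order takes finitely many values and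
    determines the sizes, so the probability is a finite sum over such pairs.\<close>
  define X where "X \<omega> = (restr (n + m) (R \<omega>), B \<omega>)" for \<omega>
  define S where "S = (SIGMA q:partitions (n + m). permutations_of_set (new_blocks n q))"
  define \<phi> where "\<phi> = (\<lambda>(q, bs :: nat set list). restr n q = p \<and> map card bs = s \<and> card (new_blocks n q) = k)"
  define P where "P q = measure M {\<omega> \<in> space M. restr (n + m) (R \<omega>) = q}" for q
  have fin: "finite S"
    unfolding S_def by (intro finite_SigmaI finite_partitions) simp
  have "{\<omega> \<in> space M. restr n (R \<omega>) = p \<and> new_sizes R n m B \<omega> = (s, k)} = {\<omega> \<in> space M. \<phi> (X \<omega>)}"
    by (auto simp: \<phi>_def X_def new_sizes_def restr_restr)
  also have "measure M \<dots> = (\<Sum>x\<in>S. measure M {\<omega> \<in> space M. X \<omega> = x} * of_bool (\<phi> x))"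
  proof (rule measure_finite_range[OF finite_measure_axioms fin])
    show "X \<omega> \<in> S" if "\<omega> \<in> space M" for \<omega>
      using restr_in_partitions[OF that] order_in_permutations[OF that] by (simp add: X_def S_def)
    show "{\<omega> \<in> space M. X \<omega> = x} \<in> sets M" for x
      using sets_order[of "fst x" "snd x"] by (simp add: X_def prod_eq_iff)
  qed
  also have "\<dots> = (\<Sum>q\<in>partitions (n + m). \<Sum>bs\<in>permutations_of_set (new_blocks n q).
      measure M {\<omega> \<in> space M. X \<omega> = (q, bs)} * of_bool (\<phi> (q, bs)))"
    unfolding S_def by (subst sum.Sigma) (auto simp: finite_partitions)
  also have "\<dots> = (\<Sum>q\<in>partitions (n + m). (P q * of_bool (card (new_blocks n q) = k) *
      real (count_orders s (new_size_mset n q)) / fact k) * of_bool (restr n q = p))"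
  proof (intro sum.cong refl)
    fix q
    assume "q \<in> partitions (n + m)"
    then have q: "partition_on {1..n + m} q"
      by (simp add: partitions_def)
    have "finite (new_blocks n q)"
      using finite_partition_on_atLeastAtMost[OF q] by (simp add: new_blocks_def)
    \<comment> \<open>Given q every order has probability 1 / k!, so it remains to count the orders
      that produce s; this number depends only on the multiset of new sizes.\<close>
    note count = card_permutations_of_set_map[OF this, of card s]
    have "(\<Sum>bs\<in>permutations_of_set (new_blocks n q).
        measure M {\<omega> \<in> space M. X \<omega> = (q, bs)} * of_bool (\<phi> (q, bs))) =
        (\<Sum>bs\<in>permutations_of_set (new_blocks n q).
          P q / fact k * of_bool (card (new_blocks n q) = k) * of_bool (restr n q = p) * of_bool (map card bs = s))"
      by (intro sum.cong refl) (auto simp: X_def P_def \<phi>_def measure_order[OF q])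
    also have "\<dots> = P q / fact k * of_bool (card (new_blocks n q) = k) * of_bool (restr n q = p) *
        real (card {bs \<in> permutations_of_set (new_blocks n q). map card bs = s})"
      unfolding sum_distrib_left[symmetric] by (simp add: Int_def)
    finally show "(\<Sum>bs\<in>permutations_of_set (new_blocks n q).
        measure M {\<omega> \<in> space M. X \<omega> = (q, bs)} * of_bool (\<phi> (q, bs))) =
        (P q * of_bool (card (new_blocks n q) = k) *
          real (count_orders s (new_size_mset n q)) / fact k) * of_bool (restr n q = p)"
      unfolding count new_size_mset_def by simp
  qed
  also have "\<dots> = (\<Sum>q\<in>extensions p n (n + m). P q * of_bool (card (new_blocks n q) = k) *
      real (count_orders s (new_size_mset n q)) / fact k)"
    by (rule sum_partitions_eq_sum_extensions)
  also have "\<dots> = (\<Sum>q\<in>extensions p n (n + m). block_weight \<alpha> q *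
      (of_bool (size (new_size_mset n q) = k) * V (n + m) (card p + k) *
        real (count_orders s (new_size_mset n q)) / fact k))"
  proof (intro sum.cong refl)
    fix q
    assume "q \<in> extensions p n (n + m)"
    then have q: "partition_on {1..n + m} q" and qp: "restr n q = p"
      by (auto simp: extensions_def)
    show "P q * of_bool (card (new_blocks n q) = k) * real (count_orders s (new_size_mset n q)) / fact k =
        block_weight \<alpha> q * (of_bool (size (new_size_mset n q) = k) * V (n + m) (card p + k) *
          real (count_orders s (new_size_mset n q)) / fact k)"
      using measure_restr[OF _ q] n card_eq_restr_plus_new[OF q, of n]
      by (auto simp: P_def qp size_new_size_mset)
  qed
  also have "\<dots> = block_weight \<alpha> p * growth \<alpha> (card p) n m
      (\<lambda>\<mu>. of_bool (size \<mu> = k) * V (n + m) (card p + k) * real (count_orders s \<mu>) / fact k)"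
    using sum_extensions_eq_growth[OF p, where F = "\<lambda>\<mu>. of_bool (size \<mu> = k) *
      V (n + m) (card p + k) * real (count_orders s \<mu>) / fact k"] .
  finally show ?thesis .
qed

lemma measurable_new_sizes: "new_sizes R n m B \<in> M \<rightarrow>\<^sub>M count_space UNIV"
proof -
  have "B \<in> M \<rightarrow>\<^sub>M count_space UNIV"
    using order unfolding exchangeable_order_def by blast
  then have 1: "(\<lambda>\<omega>. map card (B \<omega>)) \<in> M \<rightarrow>\<^sub>M count_space UNIV"
    by (rule measurable_compose) simp
  have 2: "(\<lambda>\<omega>. card (new_blocks n (restr (n + m) (R \<omega>)))) \<in> M \<rightarrow>\<^sub>M count_space UNIV"
    by (rule measurable_compose[OF measurable_restr]) simp
  have "new_sizes R n m B -` {x} \<inter> space M \<in> sets M" for x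
  proof -
    have "new_sizes R n m B -` {x} \<inter> space M =
        ((\<lambda>\<omega>. map card (B \<omega>)) -` {fst x} \<inter> space M) \<inter>
        ((\<lambda>\<omega>. card (new_blocks n (restr (n + m) (R \<omega>)))) -` {snd x} \<inter> space M)"
      by (auto simp: new_sizes_def)
    also have "\<dots> \<in> sets M"
      by (intro sets.Int measurable_sets[OF 1] measurable_sets[OF 2]) simp_all
    finally show ?thesis .
  qed
  then show ?thesis
    by (subst measurable_count_space_eq_countable) auto
qed

text \<open>Conditioning on a non-null event is a density with respect to M, so integrating against
  the law of the sizes is averaging over the atom, where \<open>card (restr n (R \<omega>))\<close>
  is \<open>card p\<close>.\<close>

lemma integral_cond_law_sizes:
  assumes pos: "0 < measure M {\<omega> \<in> space M. restr n (R \<omega>) = p}"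
  shows "(\<integral>x. P_new \<alpha> V n m l (card p) x \<partial>cond_law_sizes M R n m B p) =
    (\<integral>\<omega>. indicator {\<omega> \<in> space M. restr n (R \<omega>) = p} \<omega> * P_new_rv \<alpha> V R n m l B \<omega> \<partial>M) /
      measure M {\<omega> \<in> space M. restr n (R \<omega>) = p}"
proof -
  define A where "A = {\<omega> \<in> space M. restr n (R \<omega>) = p}"
  define f where "f \<omega> = P_new \<alpha> V n m l (card p) (new_sizes R n m B \<omega>)" for \<omega>
  have A: "A \<in> sets M"
    unfolding A_def by (rule sets_restr)
  have meas: "new_sizes R n m B \<in> uniform_measure M A \<rightarrow>\<^sub>M count_space UNIV"
    using measurable_new_sizes by (simp cong: measurable_cong_sets)
  have f: "f \<in> borel_measurable M"
    unfolding f_def by (rule measurable_compose[OF measurable_new_sizes]) simp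
  have dens: "uniform_measure M A = density M (\<lambda>\<omega>. ennreal (indicator A \<omega> / measure M A))"
    unfolding uniform_measure_def
  proof (intro arg_cong[of _ _ "density M"] ext)
    show "indicator A \<omega> / emeasure M A = ennreal (indicator A \<omega> / measure M A)" for \<omega>
      using divide_ennreal[of "indicator A \<omega>" "measure M A"] pos
      by (simp add: emeasure_eq_measure ennreal_indicator flip: A_def)
  qed
  have "(\<integral>x. P_new \<alpha> V n m l (card p) x \<partial>cond_law_sizes M R n m B p) = (\<integral>\<omega>. f \<omega> \<partial>uniform_measure M A)"
    unfolding cond_law_sizes_def A_def[symmetric] f_def by (rule integral_distr[OF meas]) simp
  also have "\<dots> = (\<integral>\<omega>. (indicator A \<omega> / measure M A) *\<^sub>R f \<omega> \<partial>M)"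
    unfolding dens using A f by (intro integral_density) auto
  also have "\<dots> = (\<integral>\<omega>. (indicator A \<omega> * P_new_rv \<alpha> V R n m l B \<omega>) / measure M A \<partial>M)"
    by (intro Bochner_Integration.integral_cong refl) (auto simp: f_def A_def P_new_rv_def indicator_def)
  finally show ?thesis
    by (simp add: A_def)
qed

lemma AE_cond_exp_P_new_rv:
  assumes "0 < measure M {\<omega> \<in> space M. restr n (R \<omega>) = p}"
  shows "AE \<omega> in M. restr n (R \<omega>) = p \<longrightarrow>
    cond_exp_restr M R n (P_new_rv \<alpha> V R n m l B) \<omega> =
      (\<integral>x. P_new \<alpha> V n m l (card p) x \<partial>cond_law_sizes M R n m B p)"
proof (rule AE_I2, rule impI)
  fix \<omega>
  assume "\<omega> \<in> space M" "restr n (R \<omega>) = p"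
  then show "cond_exp_restr M R n (P_new_rv \<alpha> V R n m l B) \<omega> =
      (\<integral>x. P_new \<alpha> V n m l (card p) x \<partial>cond_law_sizes M R n m B p)"
    using cond_exp_restr_atom[OF integrable_P_new_rv, where \<omega> = \<omega> and n = n] assms
    unfolding integral_cond_law_sizes[OF assms] by (simp add: eq_divide_eq)
qed

text \<open>The factor \<open>block_weight \<alpha> p\<close>, the only one that sees the block
  sizes of p, occurs in both the joint probability and the measure of the atom, and cancels.\<close>

lemma emeasure_cond_law_sizes:
  assumes p: "partition_on {1..n} p" and pos: "0 < V n (card p)"
  shows "emeasure (cond_law_sizes M R n m B p) {(s, k)} =
    ennreal (growth \<alpha> (card p) n m
      (\<lambda>\<mu>. of_bool (size \<mu> = k) * V (n + m) (card p + k) * real (count_orders s \<mu>) / fact k) / V n (card p))"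
proof -
  define A where "A = {\<omega> \<in> space M. restr n (R \<omega>) = p}"
  define C where "C = new_sizes R n m B -` {(s, k)} \<inter> space M"
  have A: "A \<in> sets M"
    unfolding A_def by (rule sets_restr)
  have C: "C \<in> sets M"
    unfolding C_def by (rule measurable_sets[OF measurable_new_sizes]) simp
  have meas: "new_sizes R n m B \<in> uniform_measure M A \<rightarrow>\<^sub>M count_space UNIV"
    using measurable_new_sizes by (simp cong: measurable_cong_sets)
  have w: "0 < block_weight \<alpha> p"
    by (rule block_weight_pos[OF alpha_less_1])
  have mA: "measure M A = V n (card p) * block_weight \<alpha> p"
    unfolding A_def by (rule measure_restr[OF n p])
  have "A \<inter> C = {\<omega> \<in> space M. restr n (R \<omega>) = p \<and> new_sizes R n m B \<omega> = (s, k)}"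
    by (auto simp: A_def C_def)
  then have mAC: "measure M (A \<inter> C) = block_weight \<alpha> p * growth \<alpha> (card p) n m
      (\<lambda>\<mu>. of_bool (size \<mu> = k) * V (n + m) (card p + k) * real (count_orders s \<mu>) / fact k)"
    by (simp only: measure_new_sizes[OF p])
  have "emeasure (cond_law_sizes M R n m B p) {(s, k)} = emeasure M (A \<inter> C) / emeasure M A"
    unfolding cond_law_sizes_def A_def[symmetric]
    by (subst emeasure_distr[OF meas]) (simp_all add: A C flip: C_def)
  also have "\<dots> = ennreal (measure M (A \<inter> C) / measure M A)"
    using w pos by (simp add: emeasure_eq_measure divide_ennreal mA)
  finally show ?thesis
    using w by (simp add: mA mAC)
qed

text \<open>The values lie in a countable type, so point masses determine the law, and these involve
  p only through \<open>card p\<close>.\<close>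

lemma cond_law_sizes_eq:
  assumes "partition_on {1..n} p" "partition_on {1..n} p'" "card p' = card p" "0 < V n (card p)"
  shows "cond_law_sizes M R n m B p' = cond_law_sizes M R n m B p"
proof (rule measure_eqI_countable[of _ UNIV])
  show "emeasure (cond_law_sizes M R n m B p') {x} = emeasure (cond_law_sizes M R n m B p) {x}" for x
    using assms by (cases x) (simp add: emeasure_cond_law_sizes)
qed (simp_all add: cond_law_sizes_def)

end

theorem proposition12:
  fixes M :: "'a measure" and R :: "'a \<Rightarrow> nat set set" and B :: "'a \<Rightarrow> nat set list"
    and \<alpha> :: real and V :: "nat \<Rightarrow> nat \<Rightarrow> real" and n m l j :: nat and p :: "nat set set"
  assumes "gibbs_partition M \<alpha> V R"
    and "1 \<le> n" and "1 \<le> m" and "l \<in> {1..m}"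
    and "partition_on {1..n} p" and "card p = j" and "V n j > 0"
    and "exchangeable_order M R n m B"
  shows
    "(AE \<omega> in M. restr n (R \<omega>) = p \<longrightarrow>
        cond_exp_restr M R (n + m) (indicator (next_in_new_species M R n m l)) \<omega> =
          P_new_rv \<alpha> V R n m l B \<omega>) \<and>
     (AE \<omega> in M. restr n (R \<omega>) = p \<longrightarrow>
        cond_exp_restr M R n (P_new_rv \<alpha> V R n m l B) \<omega> =
          (\<integral>x. P_new \<alpha> V n m l j x \<partial>cond_law_sizes M R n m B p)) \<and>
     (\<integral>x. P_new \<alpha> V n m l j x \<partial>cond_law_sizes M R n m B p) =
        (real l - \<alpha>) *
        (\<Sum>k = 1..1 + (m - l).
           V (n + m + 1) (j + k) / V n j * real (m choose l) * pochhammer (1 - \<alpha>) (l - 1) *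
           stirling_noncentral \<alpha> (- (real n - real j * \<alpha>)) (m - l) (k - 1)) \<and>
     (\<forall>p'. partition_on {1..n} p' \<and> card p' = j \<longrightarrow>
        cond_law_sizes M R n m B p' = cond_law_sizes M R n m B p)"
proof -
  interpret gibbs_order M \<alpha> V R n m B
    by unfold_locales (fact assms)+
  note p = \<open>partition_on {1..n} p\<close>
  have w: "0 < block_weight \<alpha> p"
    by (rule block_weight_pos[OF alpha_less_1])
  have mp: "measure M {\<omega> \<in> space M. restr n (R \<omega>) = p} = V n j * block_weight \<alpha> p"
    using measure_restr[OF n p] by (simp add: \<open>card p = j\<close>)
  then have pos: "0 < measure M {\<omega> \<in> space M. restr n (R \<omega>) = p}"
    using w \<open>V n j > 0\<close> by simp
  have "AE \<omega> in M. restr n (R \<omega>) = p \<longrightarrow>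
      cond_exp_restr M R (n + m) (indicator (next_in_new_species M R n m l)) \<omega> =
        P_new_rv \<alpha> V R n m l B \<omega>"
    using AE_cond_exp_next_in_new_species[of l] by (rule AE_mp) (rule AE_I2, rule impI, rule impI)
  moreover note AE_cond_exp_P_new_rv[OF pos, of l, unfolded \<open>card p = j\<close>]
  moreover have "(\<integral>x. P_new \<alpha> V n m l j x \<partial>cond_law_sizes M R n m B p) =
        (real l - \<alpha>) *
        (\<Sum>k = 1..1 + (m - l).
           V (n + m + 1) (j + k) / V n j * real (m choose l) * pochhammer (1 - \<alpha>) (l - 1) *
           stirling_noncentral \<alpha> (- (real n - real j * \<alpha>)) (m - l) (k - 1))"
  proof -
    have cancel: "block_weight \<alpha> p * (real l - \<alpha>) * x / (V n j * block_weight \<alpha> p) = (real l - \<alpha>) * (x / V n j)" for x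
      using w by simp
    then show ?thesis
      using integral_cond_law_sizes[OF pos, of l]
      unfolding integral_P_new_rv_atom integral_predictor[OF p \<open>l \<in> {1..m}\<close>] mp \<open>card p = j\<close> cancel
      by (simp only: sum_divide_distrib times_divide_eq_left)
  qed
  moreover have "\<forall>p'. partition_on {1..n} p' \<and> card p' = j \<longrightarrow>
      cond_law_sizes M R n m B p' = cond_law_sizes M R n m B p"
    using \<open>card p = j\<close> \<open>V n j > 0\<close> by (intro allI impI cond_law_sizes_eq[OF p]) simp_all
  ultimately show ?thesis
    by (intro conjI)
qed

end
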